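(* Let $\mathbf{h}=(h_0,\dots,h_d)\in\mathbb{N}^{d+1}$ with $h_0=1$ and $h_d=0$, and let $\partial h_j=\sum_{i=0}^j(h_i-h_{d-i})$. (a) If $\partial h_j>0$ for $0\le j\le\lfloor(d-1)/2\rfloor$, then there exists a simplicial poset $P$ such that $|\Gamma(P)|$ is a $(d-1)$-ball and $h(P)=\mathbf{h}$. (b) Alternatively, suppose $\partial h_j\ge 0$ for all $0\le j\le\lfloor(d-1)/2\rfloor$ and let $n$ with $0<n\le\lfloor(d-1)/2\rfloor$ be the smallest number such that $\partial h_n=0$. If $\sum_{i=0}^d h_i$ is even and $\partial h_l\le\sum_{i=0}^{n-1}h_{l-i}$ for $n+1\le l\le d-(n+1)$, then there exists a simplicial poset $P$ such that $|\Gamma(P)|$ is a $(d-1)$-ball and $h(P)=\mathbf{h}$.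
   Context: A simplicial poset is a finite poset $P$ with a minimum element $\hat 0$ such that for every $p\in P$ the closed interval $[\hat 0,p]$ is a Boolean algebra. There is a regular CW-complex $\Gamma(P)$ whose face poset is $P$ ($\hat 0$ corresponding to the empty face). Its closed faces are simplices, but distinct faces may have the same vertex set. An element $p$ with $[\hat0,p]$ Boolean of rank $i+1$ is an $i$-dimensional face. $f_i(P)$ is the number of $i$-dimensional faces ($f_{-1}=1$), and $P$ has dimension $d-1$ if $d-1$ is the largest $i$ with $f_i\neq 0$. For a $(d-1)$-dimensional simplicial poset the $h$-vector $h(P)=(h_0,\dots,h_d)$ is defined by $\sum_{i=0}^d h_ix^i=\sum_{i=0}^d f_{i-1}x^i(1-x)^{d-i}$. $|\Gamma(P)|$ denotes the geometric realization. *)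

theory Defs
  imports "HOL-Analysis.Analysis" "HOL-Computational_Algebra.Polynomial"
begin

definition finite_poset_with_min :: "'a set \<Rightarrow> ('a \<Rightarrow> 'a \<Rightarrow> bool) \<Rightarrow> 'a \<Rightarrow> bool" where
  "finite_poset_with_min P le z \<longleftrightarrow>
     finite P \<and>
     (\<forall>p\<in>P. le p p) \<and>
     (\<forall>p\<in>P. \<forall>q\<in>P. le p q \<and> le q p \<longrightarrow> p = q) \<and>
     (\<forall>p\<in>P. \<forall>q\<in>P. \<forall>r\<in>P. le p q \<and> le q r \<longrightarrow> le p r) \<and>
     z \<in> P \<and> (\<forall>p\<in>P. le z p)"

definition closed_interval :: "'a set \<Rightarrow> ('a \<Rightarrow> 'a \<Rightarrow> bool) \<Rightarrow> 'a \<Rightarrow> 'a \<Rightarrow> 'a set" where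
  "closed_interval P le a b = {q\<in>P. le a q \<and> le q b}"

definition boolean_of_rank :: "'a set \<Rightarrow> ('a \<Rightarrow> 'a \<Rightarrow> bool) \<Rightarrow> 'a \<Rightarrow> 'a \<Rightarrow> nat \<Rightarrow> bool" where
  "boolean_of_rank P le z p k \<longleftrightarrow>
     (\<exists>(S::nat set) (g::'a \<Rightarrow> nat set). finite S \<and> card S = k \<and>
        bij_betw g (closed_interval P le z p) (Pow S) \<and>
        (\<forall>q\<in>closed_interval P le z p. \<forall>r\<in>closed_interval P le z p.
            le q r \<longleftrightarrow> g q \<subseteq> g r))"

definition simplicial_poset :: "'a set \<Rightarrow> ('a \<Rightarrow> 'a \<Rightarrow> bool) \<Rightarrow> 'a \<Rightarrow> bool" where
  "simplicial_poset P le z \<longleftrightarrow>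
     finite_poset_with_min P le z \<and> (\<forall>p\<in>P. \<exists>k. boolean_of_rank P le z p k)"

text \<open>fnum P le z i = f_{i-1}(P): the number of (i-1)-dimensional faces,
  i.e. elements p with [z,p] Boolean of rank i. (So fnum P le z 0 = f_{-1} = 1.)\<close>
definition fnum :: "'a set \<Rightarrow> ('a \<Rightarrow> 'a \<Rightarrow> bool) \<Rightarrow> 'a \<Rightarrow> nat \<Rightarrow> nat" where
  "fnum P le z i = card {p\<in>P. boolean_of_rank P le z p i}"

text \<open>P has dimension d-1: d-1 is the largest i with f_i \<noteq> 0.\<close>
definition has_dim :: "'a set \<Rightarrow> ('a \<Rightarrow> 'a \<Rightarrow> bool) \<Rightarrow> 'a \<Rightarrow> nat \<Rightarrow> bool" where
  "has_dim P le z d \<longleftrightarrow> fnum P le z d \<noteq> 0 \<and> (\<forall>i>d. fnum P le z i = 0)"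

definition h_vector_is :: "'a set \<Rightarrow> ('a \<Rightarrow> 'a \<Rightarrow> bool) \<Rightarrow> 'a \<Rightarrow> nat \<Rightarrow> (nat \<Rightarrow> nat) \<Rightarrow> bool" where
  "h_vector_is P le z d h \<longleftrightarrow>
     (\<Sum>i\<le>d. monom (int (h i)) i) =
     (\<Sum>i\<le>d. smult (int (fnum P le z i)) ([:0, 1:] ^ i * [:1, -1:] ^ (d - i)) :: int poly)"

text \<open>Geometric realization |Gamma(P)|, realized as the geometric realization of the
  order complex of P - {z} (the barycentric subdivision of Gamma(P)), inside
  the product space 'a \<Rightarrow> real: barycentric coordinates supported on a chain.\<close>
definition realization :: "'a set \<Rightarrow> ('a \<Rightarrow> 'a \<Rightarrow> bool) \<Rightarrow> 'a \<Rightarrow> ('a \<Rightarrow> real) set" where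
  "realization P le z =
     {t. (\<forall>q. 0 \<le> t q) \<and> (\<forall>q. q \<notin> P - {z} \<longrightarrow> t q = 0) \<and>
         (\<Sum>q\<in>P - {z}. t q) = 1 \<and>
         (\<forall>q r. t q \<noteq> 0 \<and> t r \<noteq> 0 \<longrightarrow> le q r \<or> le r q)}"

definition closed_ball_space :: "nat \<Rightarrow> (nat \<Rightarrow> real) topology" where
  "closed_ball_space m = subtopology (Euclidean_space m) {x. (\<Sum>i<m. (x i)\<^sup>2) \<le> 1}"

definition is_ball_of_dim :: "('a \<Rightarrow> real) set \<Rightarrow> nat \<Rightarrow> bool" where
  "is_ball_of_dim X m \<longleftrightarrow> subtopology (powertop_real UNIV) X homeomorphic_space closed_ball_space m"

definition partial_h :: "nat \<Rightarrow> (nat \<Rightarrow> nat) \<Rightarrow> nat \<Rightarrow> int" where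
  "partial_h d h j = (\<Sum>i\<le>j. int (h i) - int (h (d - i)))"

end

theory Submission
  imports Defs "HOL-Library.Multiset" "HOL-Library.Nat_Bijection"
begin

text \<open>All simplicial posets constructed here are obtained by attaching \<open>(d - 1)\<close>-simplices, with vertices
  coloured by \<open>{..<d}\<close>, one after the other; the new simplex is attached along its facets opposite the colours in
  a set \<open>T\<close> (a proper nonempty subset), and contributes \<open>x\<^bsup>|T|\<^esup>\<close> to the \<open>h\<close>-polynomial. So \<open>h\<close> has to be
  realized by a suitable order of its types \<open>|T|\<close>.

  In case (a), sort the types other than \<open>0\<close> as \<open>m\<^sub>1 \<le> \<dots> \<le> m\<^sub>r\<close>. Positivity of \<open>\<partial>h\<close> means
  \<open>m\<^sub>k + m\<^bsub>r+1-k\<^esub> \<le> d\<close>, so attaching them from the middle outwards, any two consecutive types have sum at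
  most \<open>d\<close>, and every simplex can be attached to free facets of its predecessor alone. In case (b),
  the types strictly between \<open>n\<close> and \<open>d - n\<close> come first, in pairs \<open>m\<^sub>k, m\<^bsub>r+1-k\<^esub>\<close> with sums between \<open>d - n\<close>
  and \<open>d\<close>; such a pair leaves intact a part of the boundary that consists of \<open>d - n\<close> facets of a simplex. A simplex of
  type \<open>d - n\<close> is attached to that part, and the remaining types follow as in case (a).

  That the realization remains a ball is seen by viewing the new simplex as a lens over the part of the boundary
  sphere to which it is attached: it thickens a star-shaped model of the ball in the radial
  direction.\<close>

section \<open>Gluing data\<close>

text \<open>Let \<open>A l\<close> count the types in \<open>{1..l}\<close> and \<open>B l\<close>
  those in \<open>{d - l..<d}\<close>; since \<open>h 0 = 1\<close> and \<open>h d = 0\<close>,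
  \<open>partial_h d h l = 1 + A l - B l\<close>. In (a) positivity says
  \<open>B l \<le> A l\<close>, which for a sorted list bounds the sums of opposite entries. In (b)
  \<open>B n = 1 + A n\<close>: one copy of \<open>d - n\<close> has no small partner. With it set
  aside, the nonzero types outside the middle range number \<open>2 * A n\<close>, so evenness of
  the sum of the \<open>h i\<close> makes the number of middle types even and they can be paired off
  completely. The remaining hypothesis at \<open>l = n + j\<close> reads
  \<open>1 + A j \<le> B (n + j)\<close>; subtracting \<open>1 + A n = B n\<close> leaves a
  statement on middle types only, from which the lower bound \<open>d - n\<close> for opposite sums
  follows. Topologically, the obstacle is that an attaching patch must look like part of the
  boundary of a single simplex, and that its interior faces must lie in no other boundary facet.
  Both requirements are expressed by \<open>gluable\<close>.\<close>

text \<open>The newest simplex comes first in the list. For \<open>g\<close> in position \<open>k\<close> from the end, \<open>g c = Some j\<close> means that the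
  facet of simplex \<open>k\<close> opposite colour \<open>c\<close> is identified with that of simplex \<open>j\<close>. The face of simplex \<open>k\<close> with colours
  \<open>S\<close> is represented by the first simplex that contains it, \<open>rep S gs k\<close>.\<close>

primrec rep :: "nat set \<Rightarrow> (nat \<rightharpoonup> nat) list \<Rightarrow> nat \<Rightarrow> nat" where
  "rep S [] k = k"
| "rep S (g # gs) k =
     (if k = length gs \<and> \<not> dom g \<subseteq> S then rep S gs (the (g (SOME c. c \<in> dom g - S)))
      else rep S gs k)"

primrec free_facets :: "nat \<Rightarrow> (nat \<rightharpoonup> nat) list \<Rightarrow> (nat \<times> nat) set" where
  "free_facets d [] = {}"
| "free_facets d (g # gs) =
     {(j, c). (j, c) \<in> free_facets d gs \<and> g c \<noteq> Some j} \<union> {length gs} \<times> ({..<d} - dom g)"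

text \<open>The sets \<open>S\<close> with \<open>{..<d} - S \<subseteq> R\<close> describe the
  faces interior to the union of the facets with colours in \<open>R\<close>. That
  \<open>j = \<rho> c\<close> implies equality means that the chosen facets share these faces as the
  facets of one simplex do. The converse says that no further free facet contains them, so attaching
  a simplex removes them from the boundary.\<close>

definition gluable :: "nat \<Rightarrow> (nat \<rightharpoonup> nat) list \<Rightarrow> nat set \<Rightarrow> (nat \<Rightarrow> nat) \<Rightarrow> bool" where
  "gluable d gs R \<rho> \<longleftrightarrow> R \<subseteq> {..<d} \<and> (\<forall>c\<in>R. (\<rho> c, c) \<in> free_facets d gs) \<and>
     (\<forall>S c c' j. {..<d} - S \<subseteq> R \<and> c \<in> {..<d} - S \<and> c' \<in> {..<d} - S \<and> (j, c) \<in> free_facets d gs \<longrightarrow>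
        (rep S gs j = rep S gs (\<rho> c') \<longleftrightarrow> j = \<rho> c))"

text \<open>Since \<open>dom g\<close> is nonempty and proper, the patch of attachment is a ball,
  neither empty nor a whole sphere.\<close>

inductive glued :: "nat \<Rightarrow> (nat \<rightharpoonup> nat) list \<Rightarrow> bool" for d where
  single: "glued d [Map.empty]"
| attach: "glued d gs \<Longrightarrow> dom g \<noteq> {} \<Longrightarrow> dom g \<subset> {..<d} \<Longrightarrow>
    gluable d gs (dom g) (\<lambda>c. the (g c)) \<Longrightarrow> glued d (g # gs)"

lemma free_facetsD: "(j, c) \<in> free_facets d gs \<Longrightarrow> j < length gs \<and> c < d"
  by (induction gs) auto

lemma finite_free_facets: "finite (free_facets d gs)"
  by (rule finite_subset[of _ "{..<length gs} \<times> {..<d}"]) (auto dest: free_facetsD)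

lemma gluableD_free: "gluable d gs R \<rho> \<Longrightarrow> c \<in> R \<Longrightarrow> (\<rho> c, c) \<in> free_facets d gs"
  by (auto simp: gluable_def)

lemma gluableD_less: "gluable d gs R \<rho> \<Longrightarrow> c \<in> R \<Longrightarrow> \<rho> c < length gs"
  using free_facetsD gluableD_free by blast

lemma gluableD_iff:
  "gluable d gs R \<rho> \<Longrightarrow> {..<d} - S \<subseteq> R \<Longrightarrow> c \<in> {..<d} - S \<Longrightarrow> c' \<in> {..<d} - S \<Longrightarrow>
    (j, c) \<in> free_facets d gs \<Longrightarrow> rep S gs j = rep S gs (\<rho> c') \<longleftrightarrow> j = \<rho> c"
  by (simp add: gluable_def)

lemma gluableD_rep:
  assumes "gluable d gs R \<rho>" "{..<d} - S \<subseteq> R" "c \<in> {..<d} - S" "c' \<in> {..<d} - S"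
  shows "rep S gs (\<rho> c) = rep S gs (\<rho> c')"
  using gluableD_iff[OF assms] gluableD_free[OF assms(1)] assms(2,3) by blast

lemma gluableI:
  assumes "R \<subseteq> {..<d}" "\<And>c. c \<in> R \<Longrightarrow> (\<rho> c, c) \<in> free_facets d gs"
    and "\<And>S c c' j. {..<d} - S \<subseteq> R \<Longrightarrow> c \<in> R - S \<Longrightarrow> c' \<in> R - S \<Longrightarrow> (j, c) \<in> free_facets d gs \<Longrightarrow>
       rep S gs j = rep S gs (\<rho> c') \<longleftrightarrow> j = \<rho> c"
  shows "gluable d gs R \<rho>"
  unfolding gluable_def
proof (intro conjI ballI allI impI)
  fix S c c' j
  assume *: "{..<d} - S \<subseteq> R \<and> c \<in> {..<d} - S \<and> c' \<in> {..<d} - S \<and> (j, c) \<in> free_facets d gs"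
  then have "c \<in> R - S" "c' \<in> R - S" by blast+
  with * show "rep S gs j = rep S gs (\<rho> c') \<longleftrightarrow> j = \<rho> c" using assms(3) by blast
qed (use assms in auto)

lemma gluable_subset:
  assumes "gluable d gs R \<rho>" "R' \<subseteq> R" "\<And>c. c \<in> R' \<Longrightarrow> \<rho> c = \<rho>' c"
  shows "gluable d gs R' \<rho>'"
proof (rule gluableI)
  show R': "R' \<subseteq> {..<d}" using assms by (auto simp: gluable_def)
  show "(\<rho>' c, c) \<in> free_facets d gs" if "c \<in> R'" for c
    using gluableD_free[OF assms(1), of c] that assms(2,3) by auto
  show "rep S gs j = rep S gs (\<rho>' c') \<longleftrightarrow> j = \<rho>' c"
    if "{..<d} - S \<subseteq> R'" "c \<in> R' - S" "c' \<in> R' - S" "(j, c) \<in> free_facets d gs" for S c c' j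
    using gluableD_iff[OF assms(1) _ _ _ that(4), of S c'] that assms(2,3) R' by auto
qed

lemma rep_Cons_less: "k < length gs \<Longrightarrow> rep S (g # gs) k = rep S gs k"
  by simp

lemma rep_ge: "length gs \<le> k \<Longrightarrow> rep S gs k = k"
  by (induction gs) auto

lemma rep_Cons_length_subset: "dom g \<subseteq> S \<Longrightarrow> rep S (g # gs) (length gs) = length gs"
  by (simp add: rep_ge)

lemma rep_le: "glued d gs \<Longrightarrow> rep S gs k \<le> k"
proof (induction arbitrary: k rule: glued.induct)
  case (attach gs g)
  let ?c = "SOME c. c \<in> dom g - S"
  have "the (g ?c) < length gs" if "\<not> dom g \<subseteq> S"
  proof -
    have "?c \<in> dom g - S" using that someI_ex[of "\<lambda>c. c \<in> dom g - S"] by blast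
    then show ?thesis using gluableD_less[OF attach.hyps(4)] by blast
  qed
  moreover have "rep S gs (the (g ?c)) \<le> the (g ?c)" by (rule attach.IH)
  ultimately have "rep S gs (the (g ?c)) \<le> length gs" if "\<not> dom g \<subseteq> S"
    using that by (meson less_imp_le order_trans)
  then show ?case using attach.IH[of k] by simp
qed simp

text \<open>The rep does not depend on the colour chosen in its definition; transitivity of the face
  order rests on this.\<close>
lemma rep_rep:
  assumes "glued d gs" "S \<subseteq> S'"
  shows "rep S gs (rep S' gs k) = rep S gs k"
    and "\<And>g c c'. gluable d gs (dom g) (\<lambda>c. the (g c)) \<Longrightarrow> c \<in> dom g - S \<Longrightarrow> c' \<in> dom g - S \<Longrightarrow>
      rep S gs (the (g c)) = rep S gs (the (g c'))"
proof -
  \<comment> \<open>The identity for nested colour sets is a premise here, so that this claim can be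
    used for the shorter list inside the induction that proves the identity.\<close>
  have *: "rep S gs (the (g c)) = rep S gs (the (g c'))"
    if "\<And>S' k. S \<subseteq> S' \<Longrightarrow> rep S gs (rep S' gs k) = rep S gs k"
      "gluable d gs (dom g) (\<lambda>c. the (g c))" "c \<in> dom g - S" "c' \<in> dom g - S" for g c c' S gs
  proof -
    \<comment> \<open>Its complement is exactly \<open>dom g - S\<close>, so \<open>gluable\<close>
      applies to it; the premise on \<open>rep\<close> then carries the equality down to
      \<open>S\<close>.\<close>
    let ?S' = "{..<d} - (dom g - S) \<union> S"
    have "dom g \<subseteq> {..<d}" using that(2) by (auto simp: gluable_def)
    then have "rep ?S' gs (the (g c)) = rep ?S' gs (the (g c'))"
      using that(3,4) by (intro gluableD_rep[OF that(2)]) auto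
    then show ?thesis using that(1)[of ?S'] by (metis Un_upper2)
  qed
  have **: "rep S gs (rep S' gs k) = rep S gs k" if "S \<subseteq> S'" for S S' k
    using assms(1) that
  proof (induction arbitrary: S S' k rule: glued.induct)
    case (attach gs g)
    show ?case
    proof (cases "k = length gs \<and> \<not> dom g \<subseteq> S'")
      case True
      let ?c = "SOME c. c \<in> dom g - S'" and ?c' = "SOME c. c \<in> dom g - S"
      have c: "?c \<in> dom g - S'" using True someI_ex[of "\<lambda>c. c \<in> dom g - S'"] by blast
      have c': "?c' \<in> dom g - S" using c attach.prems someI_ex[of "\<lambda>c. c \<in> dom g - S"] by blast
      have less: "rep S' gs (the (g ?c)) < length gs"
        using rep_le[OF attach.hyps(1)] gluableD_less[OF attach.hyps(4)] c
        by (meson DiffD1 order_le_less_trans)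
      have "rep S (g # gs) (rep S' (g # gs) k) = rep S gs (rep S' gs (the (g ?c)))"
        using True less by simp
      also have "\<dots> = rep S gs (the (g ?c))" by (rule attach.IH[OF attach.prems])
      also have "\<dots> = rep S gs (the (g ?c'))"
        using *[OF attach.IH attach.hyps(4) _ c'] c attach.prems by blast
      also have "\<dots> = rep S (g # gs) k" using True c attach.prems by auto
      finally show ?thesis .
    next
      case False
      show ?thesis
      proof (cases "k < length gs")
        case True
        then have "rep S' gs k < length gs" using rep_le[OF attach.hyps(1), of S' k] by simp
        then show ?thesis using True attach.IH[OF attach.prems, of k] by simp
      next
        case nless: False
        then have "rep S' (g # gs) k = k" using False by (auto simp: rep_ge)
        then show ?thesis by simp
      qed
    qed
  qed simp
  show "rep S gs (rep S' gs k) = rep S gs k" by (rule **[OF assms(2)])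
  show "\<And>g c c'. gluable d gs (dom g) (\<lambda>c. the (g c)) \<Longrightarrow> c \<in> dom g - S \<Longrightarrow> c' \<in> dom g - S \<Longrightarrow>
      rep S gs (the (g c)) = rep S gs (the (g c'))"
    by (rule *) (use ** in auto)
qed

lemma rep_Cons_length:
  assumes "glued d gs" "gluable d gs (dom g) (\<lambda>c. the (g c))" "c \<in> dom g - S"
  shows "rep S (g # gs) (length gs) = rep S gs (the (g c))"
proof -
  let ?c = "SOME c. c \<in> dom g - S"
  have "?c \<in> dom g - S" using assms(3) by (rule someI[of "\<lambda>c. c \<in> dom g - S"])
  then have "rep S gs (the (g ?c)) = rep S gs (the (g c))"
    by (rule rep_rep(2)[OF assms(1) subset_refl assms(2) _ assms(3)])
  then show ?thesis using assms(3) by auto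
qed

lemma rep_less: "glued d gs \<Longrightarrow> k < length gs \<Longrightarrow> rep S gs k < length gs"
  using rep_le order_le_less_trans by blast

text \<open>The faces of simplex \<open>k\<close> that occur in no earlier simplex are those lying
  in none of its facets of attachment. They form a Boolean interval, which later yields the
  h-polynomial.\<close>

lemma rep_eq_iff:
  assumes "glued d gs" "k < length gs"
  shows "rep S gs k = k \<longleftrightarrow> dom (rev gs ! k) \<subseteq> S"
  using assms
proof (induction rule: glued.induct)
  case (attach gs g)
  show ?case
  proof (cases "k < length gs")
    case True
    then show ?thesis using attach.IH by (simp add: nth_append)
  next
    case False
    then have k: "k = length gs" using attach.prems by simp
    have "rep S (g # gs) k \<noteq> k" if "c \<in> dom g - S" for c
      using rep_Cons_length[OF attach.hyps(1,4) that] k rep_less[OF attach.hyps(1)]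
        gluableD_less[OF attach.hyps(4), of c] that by (metis DiffD1 nat_neq_iff)
    then show ?thesis using k rep_Cons_length_subset[of g S gs]
      by (cases "dom g \<subseteq> S") (simp_all add: nth_append, blast)
  qed
qed (auto simp: rep_ge)

lemma glued_length: "glued d gs \<Longrightarrow> 0 < length gs"
  by (erule glued.cases) auto

lemma glued_dom: "glued d gs \<Longrightarrow> k < length gs \<Longrightarrow> dom (rev gs ! k) \<subseteq> {..<d}"
proof (induction rule: glued.induct)
  case (attach gs g)
  then show ?case by (cases "k = length gs") (simp_all add: nth_append psubset_imp_subset)
qed simp

lemma glued_dom_0: "glued d gs \<Longrightarrow> k < length gs \<Longrightarrow> dom (rev gs ! k) = {} \<longleftrightarrow> k = 0"
proof (induction rule: glued.induct)
  case (attach gs g)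
  then show ?case
    using glued_length[OF attach.hyps(1)] by (cases "k = length gs") (simp_all add: nth_append)
qed simp

text \<open>A simplex representing the empty face must be attached along nothing, and only the first
  one is. So all simplices share one empty face.\<close>

lemma rep_empty: "glued d gs \<Longrightarrow> k < length gs \<Longrightarrow> rep {} gs k = 0"
  using rep_rep(1)[of d gs "{}" "{}" k] rep_eq_iff[of d gs "rep {} gs k" "{}"] glued_dom_0[of d gs "rep {} gs k"]
    rep_less by auto

text \<open>A face interior to this patch has all colours of \<open>dom (hd gs)\<close>, so it first
  occurs in the newest simplex and no earlier simplex contains it.\<close>

lemma gluable_last:
  assumes "glued d gs"
  shows "gluable d gs ({..<d} - dom (hd gs)) (\<lambda>_. length gs - 1)"
proof -
  obtain g gs' where gs: "gs = g # gs'" using glued_length[OF assms] by (cases gs) auto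
  have r: "rep S gs (length gs') = length gs'" if "{..<d} - S \<subseteq> {..<d} - dom (hd gs)" for S
    using rep_Cons_length_subset[of g S gs'] that glued_dom[OF assms, of "length gs'"] gs
    by (auto simp: nth_append)
  have "j = length gs'" if "(j, c) \<in> free_facets d gs" "rep S gs j = length gs'" for j c S
    using rep_le[OF assms, of S j] free_facetsD[OF that(1)] that(2) gs by simp
  with r show ?thesis unfolding gluable_def by (fastforce simp: gs)
qed

declare rep.simps(2) [simp del] rep_Cons_less [simp]

text \<open>Attaching two simplices of types \<open>i\<close> and \<open>t\<close>, the second along the first, does not change the
  shape of the part of the boundary spanned by the colours below \<open>m\<close>, provided \<open>m \<le> i + t\<close>.\<close>
lemma gluable_pair:
  fixes \<rho> :: "nat \<Rightarrow> nat" and i t m d :: nat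
  defines "g \<equiv> \<lambda>c. if c < i then Some (\<rho> c) else None"
    and "g' \<equiv> \<lambda>gs :: (nat \<rightharpoonup> nat) list. \<lambda>c. if i \<le> c \<and> c < i + t then Some (length gs) else None"
  assumes gl: "glued d gs" and R: "gluable d gs {..<m} \<rho>"
    and it: "0 < i" "i \<le> m" "0 < t" "i + t \<le> d" "m \<le> i + t"
  shows "glued d (g' gs # g # gs)"
    and "gluable d (g' gs # g # gs) {..<m} (\<lambda>c. if c < i then Suc (length gs) else \<rho> c)"
proof -
  let ?k = "length gs" and ?h = "g' gs"
  have dg: "dom g = {..<i}" "dom ?h = {i..<i+t}"
    by (auto simp: g_def g'_def dom_def)
  have Rg: "gluable d gs (dom g) (\<lambda>c. the (g c))"
    using it by (intro gluable_subset[OF R]) (auto simp: dg g_def split: if_splits)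
  have gl1: "glued d (g # gs)"
    using it by (intro glued.attach[OF gl _ _ Rg]) (auto simp: dg psubset_eq)
  have Rh: "gluable d (g # gs) (dom ?h) (\<lambda>c. the (?h c))"
    using it by (intro gluable_subset[OF gluable_last[OF gl1]])
      (auto simp: dg g'_def split: if_splits)
  show gl2: "glued d (?h # g # gs)"
  proof (rule glued.attach[OF gl1 _ _ Rh])
    show "dom ?h \<noteq> {}" using it by (simp add: dg)
    have "0 \<in> {..<d}" "0 \<notin> dom ?h" "dom ?h \<subseteq> {..<d}" using it by (auto simp: dg)
    then show "dom ?h \<subset> {..<d}" by blast
  qed
  \<comment> \<open>For colours below \<open>i\<close> the first new simplex covers the old patch
    and the second offers its own facets instead; for colours from \<open>i\<close> on the old
    facets stay in place.\<close>
  let ?r = "\<lambda>c. if c < i then Suc ?k else \<rho> c"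
  let ?G = "?h # g # gs"
  have rk_less: "rep S ?G j = rep S gs j" if "j < ?k" for S j using that by simp
  have rk0: "rep S ?G ?k = ?k" if "{..<i} \<subseteq> S" for S
    using that rep_Cons_length_subset[of g S gs] dg by simp
  have rk: "rep S ?G ?k = rep S gs (\<rho> c)" if "c < i" "c \<notin> S" for S c
    using that rep_Cons_length[OF gl Rg, of c S] dg by (simp add: g_def)
  have rk1: "rep S ?G (Suc ?k) = (if {i..<i+t} \<subseteq> S then Suc ?k else rep S ?G ?k)" for S
  proof (cases "{i..<i+t} \<subseteq> S")
    case True then show ?thesis using rep_Cons_length_subset[of ?h S "g # gs"] dg by simp
  next
    case False
    then obtain c where "c \<in> {i..<i+t}" "c \<notin> S" by blast
    then have c: "c \<in> dom ?h - S" by (simp add: dg)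
    then have "rep S ?G (length (g # gs)) = rep S (g # gs) (the (?h c))"
      by (rule rep_Cons_length[OF gl1 Rh])
    moreover have "the (?h c) = ?k" using c by (auto simp: g'_def split: if_splits)
    ultimately show ?thesis using False by simp
  qed
  have \<rho>free: "(\<rho> c, c) \<in> free_facets d gs" "\<rho> c < ?k" if "c < m" for c
    using gluableD_free[OF R] gluableD_less[OF R] that by auto
  have free: "(j, c) \<in> free_facets d ?G \<longleftrightarrow>
      (j < ?k \<and> (j, c) \<in> free_facets d gs \<and> \<not> (c < i \<and> j = \<rho> c)) \<or> (j = Suc ?k \<and> c < i)" if "c < m" for j c
    using that it by (auto simp: dg dest: free_facetsD) (auto simp: g_def g'_def split: if_splits)
  show "gluable d ?G {..<m} ?r"
  proof (rule gluableI, goal_cases)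
    case 1
    then show ?case using it by auto
  next
    case (2 c)
    then show ?case using free \<rho>free by auto
  next
    case (3 S c c' j)
    then have U: "{..<d} - S \<subseteq> {..<m}" and c: "c < m" "c \<notin> S" and c': "c' < m" "c' \<notin> S"
      and "(j, c) \<in> free_facets d ?G" by auto
    then have f: "(j < ?k \<and> (j, c) \<in> free_facets d gs \<and> \<not> (c < i \<and> j = \<rho> c)) \<or> (j = Suc ?k \<and> c < i)"
      using free by blast
    \<comment> \<open>By \<open>U\<close> all colours from \<open>m\<close> on belong to
      \<open>S\<close>, so \<open>m \<le> i + t\<close> makes the two ranges
      interchangeable.\<close>
    have it_iff: "{i..<i+t} \<subseteq> S \<longleftrightarrow> {i..<m} \<subseteq> S"
      using it U by (auto simp: subset_iff)
    have old: "rep S gs j = rep S gs (\<rho> c'') \<longleftrightarrow> j = \<rho> c" if "j < ?k" "c'' < m" "c'' \<notin> S" for c''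
      using gluableD_iff[OF R U, of c c'' j] f that c it by auto
    have old_eq: "rep S gs (\<rho> c1) = rep S gs (\<rho> c2)" if "c1 < m" "c1 \<notin> S" "c2 < m" "c2 \<notin> S" for c1 c2
      using gluableD_rep[OF R U, of c1 c2] that it by auto
    have rl: "rep S gs (\<rho> c'') < ?k" if "c'' < m" for c''
      using rep_less[OF gl \<rho>free(2)[OF that]] .
    \<comment> \<open>The colours missing from \<open>S\<close> lie all below \<open>i\<close> (the
      face of the last simplex is new), all from \<open>i\<close> on (only old facets are involved),
      or on both sides (every copy reduces to the old face of \<open>\<rho> a\<close>).\<close>
    consider "{i..<m} \<subseteq> S" | "{..<i} \<subseteq> S" "\<not> {i..<m} \<subseteq> S" | a b where "a < i" "a \<notin> S" "i \<le> b" "b < m" "b \<notin> S"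
      by (meson atLeastLessThan_iff lessThan_iff subsetI)
    then show ?case
    proof cases
      case 1
      then have "c < i" "c' < i" using c c' by (auto simp: subset_iff not_le) (meson leI)+
      moreover have "rep S ?G j \<noteq> Suc ?k" if "j < ?k" using rk_less[OF that] rep_less[OF gl that, of S] by simp
      ultimately show ?thesis using 1 it_iff rk1[of S] f by auto
    next
      case 2
      then have ci: "i \<le> c" "i \<le> c'" using c c' by (auto simp: subset_iff not_le) (meson leI)+
      then have j: "j < ?k" using f by auto
      then show ?thesis
        using old[OF j c'] ci rk_less[OF j] rk_less[OF \<rho>free(2)[OF c'(1)]] by simp
    next
      case 3
      have nS: "\<not> {..<i} \<subseteq> S" "\<not> {i..<m} \<subseteq> S" using 3 by auto
      have k1: "rep S ?G (Suc ?k) = rep S gs (\<rho> a)"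
        using rk1[of S] rk[of a S] nS 3 it_iff by auto
      have all: "rep S ?G (?r x) = rep S gs (\<rho> a)" if "x < m" "x \<notin> S" for x
      proof (cases "x < i")
        case True then show ?thesis using k1 by simp
      next
        case False
        then have "rep S ?G (?r x) = rep S gs (\<rho> x)" using rk_less[OF \<rho>free(2)[OF that(1)], of S] by simp
        also have "\<dots> = rep S gs (\<rho> a)" using old_eq[OF that, of a] 3 it by simp
        finally show ?thesis .
      qed
      show ?thesis
      proof (cases "j < ?k")
        case True
        then show ?thesis using all[OF c'] rk_less[OF True, of S] old[OF True, of a] 3 it f by auto
      next
        case False
        then have "j = Suc ?k" "c < i" using f by auto
        then show ?thesis using all[OF c'] k1 by simp
      qed
    qed
  qed
qed

section \<open>Star-shaped balls\<close>

lemma continuous_on_coord [continuous_intros]: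
  fixes A :: "('a \<Rightarrow> 'b::topological_space) set"
  shows "continuous_on A (\<lambda>x. x i)"
  by (rule continuous_on_subset[OF continuous_on_product_coordinates]) simp

lemma continuous_on_Min [continuous_intros]:
  fixes f :: "'i \<Rightarrow> 'a::topological_space \<Rightarrow> 'b::linorder_topology"
  assumes "finite I" "I \<noteq> {}" "\<And>i. i \<in> I \<Longrightarrow> continuous_on A (f i)"
  shows "continuous_on A (\<lambda>x. Min ((\<lambda>i. f i x) ` I))"
  using assms
proof (induction I rule: finite_ne_induct)
  case (insert i I)
  then have "continuous_on A (\<lambda>x. min (f i x) (Min ((\<lambda>i. f i x) ` I)))"
    by (intro continuous_on_min) auto
  then show ?case using insert.hyps by simp
qed simp

lemma continuous_on_Max [continuous_intros]:
  fixes f :: "'i \<Rightarrow> 'a::topological_space \<Rightarrow> 'b::linorder_topology"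
  assumes "finite I" "I \<noteq> {}" "\<And>i. i \<in> I \<Longrightarrow> continuous_on A (f i)"
  shows "continuous_on A (\<lambda>x. Max ((\<lambda>i. f i x) ` I))"
  using assms
proof (induction I rule: finite_ne_induct)
  case (insert i I)
  then have "continuous_on A (\<lambda>x. max (f i x) (Max ((\<lambda>i. f i x) ` I)))"
    by (intro continuous_on_max) auto
  then show ?case using insert.hyps by simp
qed simp

lemma closed_coord_zero: "closed {x :: 'a \<Rightarrow> real. x i = 0}"
  by (intro closed_Collect_eq continuous_intros)

section \<open>Compactness of the standard simplex\<close>

definition std_simplex :: "nat \<Rightarrow> (nat \<Rightarrow> real) set" where
  "std_simplex d = {x. (\<forall>i. 0 \<le> x i) \<and> (\<forall>i\<ge>d. x i = 0) \<and> (\<Sum>i<d. x i) = 1}"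

lemma std_simplexD:
  assumes "x \<in> std_simplex d"
  shows "0 \<le> x i" "d \<le> i \<Longrightarrow> x i = 0" "(\<Sum>i<d. x i) = 1" "x i \<le> 1"
proof -
  have x: "\<And>i. 0 \<le> x i" "\<And>i. d \<le> i \<Longrightarrow> x i = 0" "(\<Sum>i<d. x i) = 1"
    using assms by (auto simp: std_simplex_def)
  from x show "0 \<le> x i" "d \<le> i \<Longrightarrow> x i = 0" "(\<Sum>i<d. x i) = 1" by auto
  show "x i \<le> 1"
  proof (cases "i < d")
    case True
    then have "x i \<le> (\<Sum>i<d. x i)" using x(1) by (intro member_le_sum) auto
    then show ?thesis using x by simp
  qed (use x in auto)
qed

lemma compact_unit_cube: "compact {x :: 'a \<Rightarrow> real. \<forall>i. 0 \<le> x i \<and> x i \<le> 1}"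
proof -
  have "compactin (powertop_real UNIV) (PiE (UNIV :: 'a set) (\<lambda>_. {0..1::real}))"
    by (subst compactin_PiE) auto
  moreover have "PiE (UNIV :: 'a set) (\<lambda>_. {0..1::real}) = {x. \<forall>i. 0 \<le> x i \<and> x i \<le> 1}"
    by (auto simp: PiE_def Pi_def)
  ultimately show ?thesis by (simp add: euclidean_product_topology)
qed

lemma closed_std_simplex: "closed (std_simplex d)"
proof -
  have "std_simplex d = (\<Inter>i. {x. 0 \<le> x i}) \<inter> (\<Inter>i\<in>{d..}. {x. x i = 0}) \<inter> {x. (\<Sum>i<d. x i) = 1}"
    by (auto simp: std_simplex_def)
  moreover have "closed \<dots>"
    by (intro closed_Int closed_INT ballI closed_Collect_eq closed_Collect_le continuous_intros)
  ultimately show ?thesis by simp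
qed

lemma compact_std_simplex: "compact (std_simplex d)"
proof -
  have "compact ({x. \<forall>i. 0 \<le> x i \<and> x i \<le> 1} \<inter> std_simplex d)"
    by (rule compact_Int_closed[OF compact_unit_cube closed_std_simplex])
  moreover have "{x. \<forall>i. 0 \<le> x i \<and> x i \<le> 1} \<inter> std_simplex d = std_simplex d"
    by (auto dest: std_simplexD)
  ultimately show ?thesis by simp
qed

lemma compact_std_simplex_faces:
  assumes "finite C"
  shows "compact {x \<in> std_simplex d. \<exists>c\<in>C. x c = 0}"
proof -
  have "closed (\<Union>c\<in>C. {x :: nat \<Rightarrow> real. x c = 0})"
    using assms closed_coord_zero by (intro closed_UN) auto
  then have "compact (std_simplex d \<inter> (\<Union>c\<in>C. {x. x c = 0}))"
    by (rule compact_Int_closed[OF compact_std_simplex])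
  moreover have "std_simplex d \<inter> (\<Union>c\<in>C. {x. x c = 0}) = {x \<in> std_simplex d. \<exists>c\<in>C. x c = 0}" by auto
  ultimately show ?thesis by simp
qed

section \<open>Radial functions and the star-shaped bodies they bound\<close>

abbreviation Eucl :: "nat \<Rightarrow> (nat \<Rightarrow> real) set" where
  "Eucl m \<equiv> {x. \<forall>i\<ge>m. x i = 0}"

abbreviation (input) scale :: "real \<Rightarrow> (nat \<Rightarrow> real) \<Rightarrow> nat \<Rightarrow> real" where
  "scale a z \<equiv> \<lambda>i. a * z i"

text \<open>A Minkowski functional without subadditivity: attaching a simplex may destroy the
  convexity of the body, but it remains star-shaped around the origin.\<close>

definition radial :: "nat \<Rightarrow> ((nat \<Rightarrow> real) \<Rightarrow> real) \<Rightarrow> bool" where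
  "radial m g \<longleftrightarrow> continuous_on (Eucl m) g \<and> (\<forall>z\<in>Eucl m. \<forall>a\<ge>0. g (scale a z) = a * g z) \<and>
     (\<forall>z\<in>Eucl m. z \<noteq> (\<lambda>_. 0) \<longrightarrow> 0 < g z)"

lemma radialD:
  assumes "radial m g"
  shows "continuous_on (Eucl m) g"
    and "z \<in> Eucl m \<Longrightarrow> 0 \<le> a \<Longrightarrow> g (scale a z) = a * g z"
    and "z \<in> Eucl m \<Longrightarrow> z \<noteq> (\<lambda>_. 0) \<Longrightarrow> 0 < g z"
    and "g (\<lambda>_. 0) = 0"
    and "z \<in> Eucl m \<Longrightarrow> 0 \<le> g z"
    and "z \<in> Eucl m \<Longrightarrow> g z = 0 \<Longrightarrow> z = (\<lambda>_. 0)"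
proof -
  have 2: "\<And>z a. z \<in> Eucl m \<Longrightarrow> 0 \<le> a \<Longrightarrow> g (scale a z) = a * g z"
    and 3: "\<And>z. z \<in> Eucl m \<Longrightarrow> z \<noteq> (\<lambda>_. 0) \<Longrightarrow> 0 < g z"
    using assms by (auto simp: radial_def)
  show "continuous_on (Eucl m) g" using assms by (simp add: radial_def)
  show "z \<in> Eucl m \<Longrightarrow> 0 \<le> a \<Longrightarrow> g (scale a z) = a * g z" by (rule 2)
  show "z \<in> Eucl m \<Longrightarrow> z \<noteq> (\<lambda>_. 0) \<Longrightarrow> 0 < g z" by (rule 3)
  show 4: "g (\<lambda>_. 0) = 0" using 2[of "\<lambda>_. 0" 0] by simp
  show "z \<in> Eucl m \<Longrightarrow> 0 \<le> g z" using 3[of z] 4 by fastforce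
  show "z \<in> Eucl m \<Longrightarrow> g z = 0 \<Longrightarrow> z = (\<lambda>_. 0)" using 3[of z] by auto
qed

text \<open>Formulas that normalize \<open>z\<close> by \<open>g z\<close> break down at the origin.
  A bound by \<open>g\<close>, which vanishes there, forces the right limit.\<close>

lemma radial_continuous_at_zero:
  fixes f :: "(nat \<Rightarrow> real) \<Rightarrow> real"
  assumes g: "radial m g" and f: "continuous_on (Eucl m - {\<lambda>_. 0}) f"
    and le: "\<And>z. z \<in> Eucl m \<Longrightarrow> \<bar>f z\<bar> \<le> g z"
  shows "continuous_on (Eucl m) f"
  unfolding continuous_on_eq_continuous_within
proof
  fix z :: "nat \<Rightarrow> real" assume z: "z \<in> Eucl m"
  show "continuous (at z within Eucl m) f"
  proof (cases "z = (\<lambda>_. 0)")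
    case True
    have "f (\<lambda>_. 0) = 0" using le[of "\<lambda>_. 0"] radialD(4)[OF g] by simp
    moreover have "(g \<longlongrightarrow> 0) (at z within Eucl m)"
      using radialD(1)[OF g, unfolded continuous_on_def, rule_format, OF z] radialD(4)[OF g] True by simp
    then have "(f \<longlongrightarrow> 0) (at z within Eucl m)"
      by (rule Lim_null_comparison[rotated]) (use le in \<open>auto simp: eventually_at_filter\<close>)
    ultimately show ?thesis using True by (simp add: continuous_within)
  next
    case False
    have "at z within Eucl m = at z within (Eucl m - {\<lambda>_. 0})"
      by (rule at_within_nhd[of z "- {\<lambda>_. 0}"]) (use False in auto)
    then show ?thesis using f z False by (simp add: continuous_on_eq_continuous_within)
  qed
qed

lemma radial_normalize:
  assumes "radial m g" "z \<in> Eucl m" "z \<noteq> (\<lambda>_. 0)"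
  shows "scale (1 / g z) z \<in> {z \<in> Eucl m. g z = 1}"
  using radialD(2)[OF assms(1,2), of "1 / g z"] radialD(3)[OF assms] assms(2) by simp

text \<open>A factor depending on the direction only preserves homogeneity. Since
  \<open>s \<le> 1\<close>, the unit body grows along each ray by \<open>1 / s\<close>, and the new
  function is bounded by \<open>g\<close>, which gives continuity at the origin.\<close>

lemma radial_rescale:
  assumes g: "radial m g" and s: "continuous_on {z \<in> Eucl m. g z = 1} s"
    and s01: "\<And>z. z \<in> Eucl m \<Longrightarrow> g z = 1 \<Longrightarrow> 0 < s z \<and> s z \<le> 1"
  shows "radial m (\<lambda>z. g z * s (scale (1 / g z) z))"
  unfolding radial_def
proof (intro conjI ballI allI impI)
  let ?h = "\<lambda>z. g z * s (scale (1 / g z) z)"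
  have pos: "0 < g z" if "z \<in> Eucl m" "z \<noteq> (\<lambda>_. 0)" for z
    using radialD(3)[OF g that] .
  have norm1: "scale (1 / g z) z \<in> {z \<in> Eucl m. g z = 1}" if "z \<in> Eucl m" "z \<noteq> (\<lambda>_. 0)" for z
    using radial_normalize[OF g that] .
  have sz: "0 < s (scale (1 / g z) z) \<and> s (scale (1 / g z) z) \<le> 1" if "z \<in> Eucl m" "z \<noteq> (\<lambda>_. 0)" for z
    using norm1[OF that] by (intro s01) auto
  show "continuous_on (Eucl m) ?h"
  proof (rule radial_continuous_at_zero[OF g])
    have gc: "continuous_on (Eucl m - {\<lambda>_. 0}) g"
      by (rule continuous_on_subset[OF radialD(1)[OF g]]) auto
    have "continuous_on (Eucl m - {\<lambda>_. 0}) (\<lambda>z. scale (1 / g z) z)"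
    proof (intro continuous_intros gc ballI)
      fix z assume "z \<in> Eucl m - {\<lambda>_. 0}"
      then show "g z \<noteq> 0" using pos[of z] by auto
    qed
    then have "continuous_on (Eucl m - {\<lambda>_. 0}) (\<lambda>z. s (scale (1 / g z) z))"
      by (rule continuous_on_compose2[OF s]) (intro image_subsetI norm1, auto)
    then show "continuous_on (Eucl m - {\<lambda>_. 0}) ?h"
      by (intro continuous_on_mult gc)
    show "\<bar>?h z\<bar> \<le> g z" if "z \<in> Eucl m" for z
    proof (cases "z = (\<lambda>_. 0)")
      case False
      then show ?thesis using pos[OF that] sz[OF that] by (simp add: abs_mult mult_left_le)
    qed (use radialD(4)[OF g] in simp)
  qed
  show "?h (scale a z) = a * ?h z" if z: "z \<in> Eucl m" and a: "0 \<le> a" for z a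
  proof (cases "a = 0")
    case True
    then show ?thesis using radialD(4)[OF g] by simp
  next
    case False
    then have "scale (1 / g (scale a z)) (scale a z) = scale (1 / g z) z"
      using radialD(2)[OF g z a] by (simp add: fun_eq_iff)
    then show ?thesis using radialD(2)[OF g z a] by simp
  qed
  show "0 < ?h z" if "z \<in> Eucl m" "z \<noteq> (\<lambda>_. 0)" for z
    using pos[OF that] sz[OF that] by simp
qed

text \<open>The model is the body of some radial \<open>g\<close> instead of the round ball, with
  \<open>B\<close> mapped to its boundary, so that an attachment can be absorbed by changing
  \<open>g\<close>. Compactness of \<open>X\<close> supplies the continuity of the inverse.\<close>

definition ball_pair :: "nat \<Rightarrow> 'p::t2_space set \<Rightarrow> 'p set \<Rightarrow> bool" where
  "ball_pair m X B \<longleftrightarrow> compact X \<and> B \<subseteq> X \<and>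
     (\<exists>g F. radial m g \<and> continuous_on X F \<and> inj_on F X \<and>
        F ` X = {z \<in> Eucl m. g z \<le> 1} \<and> F ` B = {z \<in> Eucl m. g z = 1})"

lemma ball_pairE:
  assumes "ball_pair m X B"
  obtains g F where "compact X" "B \<subseteq> X" "radial m g" "continuous_on X F" "inj_on F X"
    "F ` X = {z \<in> Eucl m. g z \<le> 1}" "F ` B = {z \<in> Eucl m. g z = 1}"
  using assms unfolding ball_pair_def by (elim conjE exE) (rule that; assumption)

text \<open>The radial map with inverse \<open>swap_radial N g\<close>. At the origin the quotient
  is \<open>0 / 0 = 0\<close>, so the origin stays fixed.\<close>

definition swap_radial :: "((nat \<Rightarrow> real) \<Rightarrow> real) \<Rightarrow> ((nat \<Rightarrow> real) \<Rightarrow> real) \<Rightarrow> (nat \<Rightarrow> real) \<Rightarrow> nat \<Rightarrow> real" where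
  "swap_radial g N z = scale (g z / N z) z"

lemma swap_radial:
  assumes g: "radial m g" and N: "radial m N" and z: "z \<in> Eucl m"
  shows "swap_radial g N z \<in> Eucl m" "N (swap_radial g N z) = g z"
    "swap_radial N g (swap_radial g N z) = z"
proof -
  show "swap_radial g N z \<in> Eucl m" using z by (simp add: swap_radial_def)
  have nn: "0 \<le> g z / N z" using radialD(5)[OF g z] radialD(5)[OF N z] by simp
  show *: "N (swap_radial g N z) = g z"
  proof (cases "z = (\<lambda>_. 0)")
    case False
    then have "N z \<noteq> 0" using radialD(3)[OF N z] by simp
    then show ?thesis using radialD(2)[OF N z nn] by (simp add: swap_radial_def)
  qed (simp add: swap_radial_def radialD(4)[OF g] radialD(4)[OF N])
  have **: "g (swap_radial g N z) = g z / N z * g z"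
    using radialD(2)[OF g z nn] by (simp add: swap_radial_def)
  show "swap_radial N g (swap_radial g N z) = z"
  proof (cases "z = (\<lambda>_. 0)")
    case False
    then have "0 < g z" "0 < N z" using radialD(3)[OF g z] radialD(3)[OF N z] by auto
    then show ?thesis using * ** by (subst swap_radial_def) (auto simp: fun_eq_iff swap_radial_def)
  qed (simp add: swap_radial_def)
qed

lemma swap_radial_image:
  assumes g: "radial m g" and N: "radial m N"
  shows "swap_radial g N ` {z \<in> Eucl m. g z \<le> 1} = {z \<in> Eucl m. N z \<le> 1}"
proof (intro equalityI subsetI)
  fix w assume w: "w \<in> {z \<in> Eucl m. N z \<le> 1}"
  then have "w = swap_radial g N (swap_radial N g w)" "swap_radial N g w \<in> {z \<in> Eucl m. g z \<le> 1}"
    using swap_radial[OF N g, of w] by auto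
  then show "w \<in> swap_radial g N ` {z \<in> Eucl m. g z \<le> 1}" by blast
qed (use swap_radial[OF g N] in auto)

lemma radial_sqrt_sum: "radial m (\<lambda>z. sqrt (\<Sum>i<m. (z i)\<^sup>2))"
  unfolding radial_def
proof (intro conjI ballI allI impI)
  show "continuous_on (Eucl m) (\<lambda>z. sqrt (\<Sum>i<m. (z i)\<^sup>2))" by (intro continuous_intros)
  show "sqrt (\<Sum>i<m. (scale a z i)\<^sup>2) = a * sqrt (\<Sum>i<m. (z i)\<^sup>2)" if "0 \<le> a" for a z
    using that by (simp add: power_mult_distrib flip: sum_distrib_left) (simp add: real_sqrt_mult)
  show "0 < sqrt (\<Sum>i<m. (z i)\<^sup>2)" if z: "z \<in> Eucl m" "z \<noteq> (\<lambda>_. 0)" for z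
  proof -
    obtain i where "z i \<noteq> 0" using z by (auto simp: fun_eq_iff)
    then have "i < m" using z by (metis (mono_tags, lifting) mem_Collect_eq not_le)
    then have "0 < (\<Sum>i<m. (z i)\<^sup>2)" using \<open>z i \<noteq> 0\<close> by (intro sum_pos2[of _ i]) auto
    then show ?thesis by simp
  qed
qed

text \<open>Radial projection onto the round ball. Only the origin is delicate: each coordinate of
  the image is bounded by \<open>g z\<close>, because \<open>\<bar>z i\<bar>\<close> is at most the
  Euclidean norm.\<close>

lemma ball_pair_is_ball:
  fixes X :: "('a::countable \<Rightarrow> real) set"
  assumes "ball_pair m X B"
  shows "is_ball_of_dim X m"
proof -
  let ?N = "\<lambda>z :: nat \<Rightarrow> real. sqrt (\<Sum>i<m. (z i)\<^sup>2)"
  let ?D = "{z \<in> Eucl m. ?N z \<le> 1}"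
  obtain g F where g: "radial m g" and X: "compact X" and F: "continuous_on X F" "inj_on F X"
    "F ` X = {z \<in> Eucl m. g z \<le> 1}"
    using assms by (rule ball_pairE)
  note N = radial_sqrt_sum[of m]
  let ?H = "\<lambda>x. swap_radial g ?N (F x)"
  have "continuous_on (Eucl m) (swap_radial g ?N)"
  proof (intro continuous_on_coordinatewise_then_product radial_continuous_at_zero[OF g])
    fix i
    have pos: "?N z \<noteq> 0" if "z \<in> Eucl m - {\<lambda>_. 0}" for z
      using radialD(3)[OF N, of z] that by fastforce
    show "continuous_on (Eucl m - {\<lambda>_. 0}) (\<lambda>z. swap_radial g ?N z i)"
      unfolding swap_radial_def
      by (intro continuous_intros continuous_on_subset[OF radialD(1)[OF g]] continuous_on_subset[OF radialD(1)[OF N]])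
        (use pos in auto)
    show "\<bar>swap_radial g ?N z i\<bar> \<le> g z" if z: "z \<in> Eucl m" for z
    proof -
      have "\<bar>z i\<bar> \<le> ?N z"
      proof (cases "i < m")
        case True
        then have "(z i)\<^sup>2 \<le> (\<Sum>i<m. (z i)\<^sup>2)" by (intro member_le_sum) auto
        then show ?thesis by (metis real_sqrt_abs real_sqrt_le_iff)
      qed (use z in \<open>auto intro!: sum_nonneg\<close>)
      then have "\<bar>z i\<bar> / ?N z \<le> 1" using radialD(5)[OF N z] by (auto simp: divide_le_eq_1)
      then have "g z * (\<bar>z i\<bar> / ?N z) \<le> g z" using radialD(5)[OF g z] by (rule mult_left_le)
      then show ?thesis using radialD(5)[OF g z] radialD(5)[OF N z] by (simp add: swap_radial_def abs_mult)
    qed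
  qed
  then have cont: "continuous_on X ?H"
    by (rule continuous_on_compose2[OF _ F(1)]) (use F(3) in auto)
  have inj: "inj_on ?H X"
  proof (rule inj_onI)
    fix x y assume xy: "x \<in> X" "y \<in> X" "?H x = ?H y"
    then have "F x \<in> Eucl m" "F y \<in> Eucl m" using F(3) by auto
    note eq = this[THEN swap_radial(3)[OF g N]]
    have "F x = swap_radial ?N g (?H x)" by (rule eq(1)[symmetric])
    also have "\<dots> = swap_radial ?N g (?H y)" by (simp only: xy(3))
    also have "\<dots> = F y" by (rule eq(2))
    finally have "F x = F y" .
    then show "x = y" using xy F(2) by (auto dest: inj_onD)
  qed
  have im: "?H ` X = ?D"
  proof -
    have "swap_radial g ?N ` {z \<in> Eucl m. g z \<le> 1} = ?D" by (rule swap_radial_image[OF g N])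
    then show ?thesis using F(3) by (simp add: image_image[symmetric])
  qed
  obtain G where "homeomorphism X ?D ?H G" using homeomorphism_compact[OF X cont im inj] by blast
  then have "homeomorphic_maps (top_of_set X) (top_of_set ?D) ?H G"
    by (auto simp: homeomorphism_def homeomorphic_maps_def continuous_map_in_subtopology image_subset_iff)
  moreover have "subtopology (powertop_real UNIV) X = top_of_set X"
    by (simp add: euclidean_product_topology)
  moreover have "closed_ball_space m = top_of_set ?D"
    by (auto simp: closed_ball_space_def Euclidean_space_def euclidean_product_topology subtopology_subtopology
        Int_def intro!: arg_cong[where f = "top_of_set"])
  ultimately show ?thesis unfolding is_ball_of_dim_def homeomorphic_space_def by metis
qed

section \<open>Attaching a simplex\<close>

locale lens =
  fixes d :: nat and T :: "nat set"
  assumes T: "T \<noteq> {}" "T \<subset> {..<d}"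
begin

definition low :: "(nat \<Rightarrow> real) \<Rightarrow> real" where "low x = Min ((\<lambda>c. x c) ` T)"
definition high :: "(nat \<Rightarrow> real) \<Rightarrow> real" where "high x = Min ((\<lambda>c. x c) ` ({..<d} - T))"
text \<open>The mass \<open>card T * low x\<close> taken from the coordinates in \<open>T\<close> is
  spread evenly over the others; each of them receives \<open>ratio * low x\<close>.\<close>

definition ratio :: real where "ratio = real (card T) / real (card ({..<d} - T))"

text \<open>The lines in direction \<open>1\<^sub>T / |T| - 1\<^sub>U / |U|\<close>, where \<open>U = {..<d} - T\<close>, lead from the union of the facets
  with colours in \<open>T\<close> to the union of the other facets; \<open>base\<close> is the projection to their
  starting points.\<close>
definition base :: "(nat \<Rightarrow> real) \<Rightarrow> nat \<Rightarrow> real" where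
  "base x = (\<lambda>c. if c \<in> T then x c - low x else if c < d then x c + ratio * low x else 0)"
definition lift :: "(nat \<Rightarrow> real) \<Rightarrow> real \<Rightarrow> nat \<Rightarrow> real" where
  "lift b t = (\<lambda>c. if c \<in> T then b c + t / ratio else if c < d then b c - t else 0)"

lemma finT [simp]: "finite T" using T finite_subset by blast

lemma T_less: "c \<in> T \<Longrightarrow> c < d" using T by auto

lemma ratio_pos: "0 < ratio"
proof -
  have "0 < card T" "0 < card ({..<d} - T)" using T by (auto simp: card_gt_0_iff)
  then show ?thesis unfolding ratio_def by (intro divide_pos_pos) (simp_all only: of_nat_0_less_iff)
qed

lemma ratio_mult: "ratio * card ({..<d} - T) = card T"
  using T by (auto simp: ratio_def)

lemma low_le: "c \<in> T \<Longrightarrow> low x \<le> x c"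
  by (simp add: low_def)

lemma low_attained: "\<exists>c\<in>T. low x = x c"
proof -
  have "low x \<in> (\<lambda>c. x c) ` T" unfolding low_def using T by (intro Min_in) auto
  then show ?thesis by auto
qed

lemma high_le: "c < d \<Longrightarrow> c \<notin> T \<Longrightarrow> high x \<le> x c"
  by (simp add: high_def)

lemma high_attained: "\<exists>c\<in>{..<d} - T. high x = x c"
proof -
  have "high x \<in> (\<lambda>c. x c) ` ({..<d} - T)" unfolding high_def using T by (intro Min_in) auto
  then show ?thesis by auto
qed

lemma low_eqI: "(\<And>c. c \<in> T \<Longrightarrow> v \<le> x c) \<Longrightarrow> c \<in> T \<Longrightarrow> x c = v \<Longrightarrow> low x = v"
  using low_le[of c x] low_attained[of x] by force

lemma high_eqI: "(\<And>c. c < d \<Longrightarrow> c \<notin> T \<Longrightarrow> v \<le> x c) \<Longrightarrow> c < d \<Longrightarrow> c \<notin> T \<Longrightarrow> x c = v \<Longrightarrow> high x = v"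
  using high_le[of c x] high_attained[of x] by force

lemma low_nonneg: "x \<in> std_simplex d \<Longrightarrow> 0 \<le> low x"
  using low_attained[of x] by (auto simp: std_simplexD)

lemma high_nonneg: "x \<in> std_simplex d \<Longrightarrow> 0 \<le> high x"
  using high_attained[of x] by (auto simp: std_simplexD)

lemma low_zero_iff: "x \<in> std_simplex d \<Longrightarrow> low x = 0 \<longleftrightarrow> (\<exists>c\<in>T. x c = 0)"
  using low_attained[of x] low_eqI[of 0 x] by (auto simp: std_simplexD)

lemma high_zero_iff: "x \<in> std_simplex d \<Longrightarrow> high x = 0 \<longleftrightarrow> (\<exists>c\<in>{..<d} - T. x c = 0)"
  using high_attained[of x] high_eqI[of 0 x] by (fastforce simp: std_simplexD)

lemma sum_split: "(\<Sum>c<d. f c) = (\<Sum>c\<in>T. f c) + (\<Sum>c\<in>{..<d} - T. f c)" for f :: "nat \<Rightarrow> real"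
  using T by (subst sum.union_disjoint[symmetric]) (auto intro!: sum.cong)

lemma base_in: 
  assumes "x \<in> std_simplex d"
  shows "base x \<in> std_simplex d"
proof -
  have "(\<Sum>c<d. base x c) = (\<Sum>c\<in>T. x c - low x) + (\<Sum>c\<in>{..<d} - T. x c + ratio * low x)"
    by (simp add: sum_split[of "base x"]) (simp add: base_def)
  also have "\<dots> = (\<Sum>c<d. x c) + (ratio * card ({..<d} - T) - card T) * low x"
    by (simp add: sum_split[of x] sum.distrib sum_subtractf algebra_simps)
  finally have "(\<Sum>c<d. base x c) = 1" using ratio_mult std_simplexD(3)[OF assms] by simp
  moreover have "0 \<le> base x c" for c
    using low_le[of c x] low_nonneg[OF assms] ratio_pos std_simplexD(1)[OF assms] by (simp add: base_def)
  moreover have "base x c = 0" if "d \<le> c" for c using that T_less by (force simp: base_def)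
  ultimately show ?thesis by (simp add: std_simplex_def)
qed

lemma low_base: "low (base x) = 0"
proof -
  obtain c where "c \<in> T" "low x = x c" using low_attained by blast
  then show ?thesis by (intro low_eqI[of 0 _ c]) (use low_le[of _ x] in \<open>auto simp: base_def\<close>)
qed

text \<open>With the loss of the coordinates outside \<open>T\<close> as parameter,
  \<open>high (base x)\<close> is the length of the whole lens line through \<open>x\<close>, and
  \<open>ratio * low x\<close> is the part travelled so far.\<close>

lemma high_base: "high (base x) = high x + ratio * low x"
proof -
  obtain c where "c < d" "c \<notin> T" "high x = x c" using high_attained by blast
  then show ?thesis by (intro high_eqI[of _ _ c]) (use high_le[of _ x] in \<open>auto simp: base_def\<close>)
qed

lemma base_id: "x \<in> std_simplex d \<Longrightarrow> low x = 0 \<Longrightarrow> base x = x"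
  by (auto simp: base_def fun_eq_iff std_simplexD)

lemma base_inj:
  assumes "x \<in> std_simplex d" "y \<in> std_simplex d" "base x = base y" "low x = low y"
  shows "x = y"
proof
  fix c
  have "base x c = base y c" using assms(3) by simp
  then show "x c = y c" using assms by (cases "c < d") (auto simp: base_def std_simplexD split: if_splits)
qed

text \<open>The parameter \<open>t\<close> is the loss of each coordinate outside \<open>T\<close>,
  so it may run up to \<open>high b\<close>, where the line leaves the simplex.\<close>

lemma lift:
  assumes b: "b \<in> std_simplex d" "low b = 0" and t: "0 \<le> t" "t \<le> high b"
  shows "lift b t \<in> std_simplex d" "ratio * low (lift b t) = t" "base (lift b t) = b"
proof -
  have r: "0 < ratio" by (rule ratio_pos)
  have "(\<Sum>c<d. lift b t c) = (\<Sum>c\<in>T. b c + t / ratio) + (\<Sum>c\<in>{..<d} - T. b c - t)"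
    by (simp add: sum_split[of "lift b t"]) (simp add: lift_def)
  also have "\<dots> = (\<Sum>c<d. b c) + (real (card T) / ratio - card ({..<d} - T)) * t"
    by (simp add: sum_split[of b] sum.distrib sum_subtractf algebra_simps)
  finally have "(\<Sum>c<d. lift b t c) = 1"
    using ratio_mult r std_simplexD(3)[OF b(1)] by (simp add: field_simps)
  moreover have "0 \<le> lift b t c" for c
    using high_le[of c b] t r std_simplexD(1)[OF b(1), of c] by (auto simp: lift_def intro: order_trans)
  moreover have "lift b t c = 0" if "d \<le> c" for c using that T_less by (force simp: lift_def)
  ultimately show *: "lift b t \<in> std_simplex d" by (simp add: std_simplex_def)
  obtain c where c: "c \<in> T" "b c = 0" using low_zero_iff[OF b(1)] b(2) by blast
  have low: "low (lift b t) = t / ratio"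
    using c std_simplexD(1)[OF b(1)] by (intro low_eqI[of _ _ c]) (auto simp: lift_def)
  then show "ratio * low (lift b t) = t" using r by simp
  show "base (lift b t) = b"
  proof
    fix c
    show "base (lift b t) c = b c"
      unfolding base_def low using r std_simplexD(2)[OF b(1)] by (auto simp: lift_def)
  qed
qed

lemma continuous_low [continuous_intros]: "continuous_on A low"
  unfolding low_def using T by (intro continuous_intros) auto

lemma continuous_high [continuous_intros]: "continuous_on A high"
  unfolding high_def using T by (intro continuous_intros) auto

lemma continuous_base: "continuous_on A base"
proof (rule continuous_on_coordinatewise_then_product)
  fix c
  show "continuous_on A (\<lambda>x. base x c)"
    unfolding base_def by (cases "c \<in> T"; cases "c < d") (simp_all, (intro continuous_intros)+)
qed

text \<open>The new simplex is pushed through the boundary along the lens lines: its points over the boundary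
  point \<open>b\<close> fill the part between radius \<open>1\<close> and \<open>1 + high b\<close>, so that only the radial
  function has to be changed.\<close>
lemma ball_pair_attach:
  fixes \<phi> :: "(nat \<Rightarrow> real) \<Rightarrow> 'p::t2_space"
  assumes ball: "ball_pair m X \<Delta>"
    and \<phi>: "continuous_on (std_simplex d) \<phi>" "inj_on \<phi> (std_simplex d)"
    and meet: "\<And>x. x \<in> std_simplex d \<Longrightarrow> \<phi> x \<in> X \<longleftrightarrow> (\<exists>c\<in>T. x c = 0)"
    and E: "closed E" "\<Delta> = E \<union> \<phi> ` {x \<in> std_simplex d. \<exists>c\<in>T. x c = 0}"
    and EB: "\<And>x. x \<in> std_simplex d \<Longrightarrow> \<phi> x \<in> E \<Longrightarrow> \<exists>c\<in>{..<d} - T. x c = 0"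
  shows "ball_pair m (X \<union> \<phi> ` std_simplex d) (E \<union> \<phi> ` {x \<in> std_simplex d. \<exists>c\<in>{..<d} - T. x c = 0})"
proof -
  let ?S = "std_simplex d" and ?B = "{x \<in> std_simplex d. \<exists>c\<in>T. x c = 0}"
    and ?A = "{x \<in> std_simplex d. \<exists>c\<in>{..<d} - T. x c = 0}"
  obtain g F where X: "compact X" "\<Delta> \<subseteq> X" and g: "radial m g"
    and F: "continuous_on X F" "inj_on F X" "F ` X = {z \<in> Eucl m. g z \<le> 1}" "F ` \<Delta> = {z \<in> Eucl m. g z = 1}"
    using ball by (rule ball_pairE)
  have closedX: "closed X" and closedL: "closed (\<phi> ` ?S)"
    using X(1) compact_continuous_image[OF \<phi>(1) compact_std_simplex] by (auto intro: compact_imp_closed)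
  define \<xi> where "\<xi> = the_inv_into ?S \<phi>"
  have \<xi>: "\<xi> (\<phi> x) = x" if "x \<in> ?S" for x
    unfolding \<xi>_def using \<phi>(2) that by (rule the_inv_into_f_f)
  have \<xi>cont: "continuous_on (\<phi> ` ?S) \<xi>"
    by (rule continuous_on_inv[OF \<phi>(1) compact_std_simplex]) (simp add: \<xi>)
  define G where "G = the_inv_into X F"
  have G: "G (F y) = y" if "y \<in> X" for y
    unfolding G_def using F(2) that by (rule the_inv_into_f_f)
  have Gcont: "continuous_on (F ` X) G"
    by (rule continuous_on_inv[OF F(1) X(1)]) (simp add: G)
  have FX: "F y \<in> Eucl m" "g (F y) \<le> 1" if "y \<in> X" for y
    using F(3) that by auto
  have F\<Delta>: "F y \<in> Eucl m" "g (F y) = 1" if "y \<in> \<Delta>" for y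
    using F(4) that by auto
  have G\<Delta>: "G u \<in> \<Delta>" "F (G u) = u" if "u \<in> Eucl m" "g u = 1" for u
  proof -
    have "u \<in> F ` \<Delta>" using F(4) that by simp
    then show "G u \<in> \<Delta>" "F (G u) = u" using G X(2) by auto
  qed
  have base\<Delta>: "\<phi> (base x) \<in> \<Delta>" "base x \<in> ?B" if "x \<in> ?S" for x
  proof -
    show "base x \<in> ?B" using low_zero_iff[OF base_in[OF that]] low_base base_in[OF that] by simp
    then show "\<phi> (base x) \<in> \<Delta>" using E(2) by blast
  qed
  have B_low: "low x = 0" if "x \<in> ?B" for x using that low_zero_iff by auto
  \<comment> \<open>The thickness of the lens over a boundary point. \<open>EB\<close> makes it
    vanish on \<open>E\<close>, which gives continuity on \<open>\<Delta>\<close>.\<close>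
  define \<psi> where "\<psi> = (\<lambda>y. if y \<in> \<phi> ` ?S then high (\<xi> y) else 0)"
  have \<psi>_nonneg: "0 \<le> \<psi> y" for y by (auto simp: \<psi>_def \<xi> high_nonneg)
  have \<psi>_\<phi>: "\<psi> (\<phi> x) = high x" if "x \<in> ?S" for x using that by (auto simp: \<psi>_def \<xi>)
  have \<psi>_E: "\<psi> y = 0" if "y \<in> E" for y
    using that EB high_zero_iff by (auto simp: \<psi>_def \<xi>)
  have \<psi>cont: "continuous_on \<Delta> \<psi>"
    unfolding E(2)
  proof (rule continuous_on_closed_Un[OF E(1)])
    show "closed (\<phi> ` ?B)"
      by (intro compact_imp_closed compact_continuous_image compact_std_simplex_faces
          continuous_on_subset[OF \<phi>(1)]) auto
    show "continuous_on E \<psi>"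
      using \<psi>_E by (rule continuous_on_eq[OF continuous_on_const[of E 0], OF sym])
    have "continuous_on (\<phi> ` ?B) (\<lambda>y. high (\<xi> y))"
      by (rule continuous_on_compose2[OF continuous_high[of UNIV] continuous_on_subset[OF \<xi>cont]]) auto
    then show "continuous_on (\<phi> ` ?B) \<psi>"
      by (rule continuous_on_eq) (auto simp: \<psi>_\<phi> \<xi>)
  qed
  \<comment> \<open>This factor moves the boundary from radius 1 out to \<open>1 + \<psi>\<close> in
    each direction.\<close>
  let ?s = "\<lambda>u. 1 / (1 + \<psi> (G u))"
  define g' where "g' = (\<lambda>z. g z * ?s (scale (1 / g z) z))"
  have g': "radial m g'"
    unfolding g'_def
  proof (rule radial_rescale[OF g])
    have "continuous_on {z \<in> Eucl m. g z = 1} G"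
      by (rule continuous_on_subset[OF Gcont]) (auto simp: F(3))
    then have "continuous_on {z \<in> Eucl m. g z = 1} (\<lambda>u. \<psi> (G u))"
      by (rule continuous_on_compose2[OF \<psi>cont]) (use G\<Delta> in auto)
    moreover have "1 + \<psi> (G u) \<noteq> 0" for u using \<psi>_nonneg[of "G u"] by linarith
    ultimately show "continuous_on {z \<in> Eucl m. g z = 1} ?s"
      by (intro continuous_intros) auto
    show "0 < ?s z \<and> ?s z \<le> 1" for z using \<psi>_nonneg[of "G z"] by (simp add: field_simps)
  qed
  \<comment> \<open>Radius \<open>1 + ratio * low x\<close> on the ray through the base point: it is
    1 on the patch and reaches \<open>1 + high (base x)\<close> exactly where
    \<open>high x = 0\<close>.\<close>
  define H where "H = (\<lambda>x. scale (1 + ratio * low x) (F (\<phi> (base x))))"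
  define F' where "F' = (\<lambda>y. if y \<in> X then F y else H (\<xi> y))"
  have H: "H x \<in> Eucl m" "g (H x) = 1 + ratio * low x"
    "g' (H x) = (1 + ratio * low x) / (1 + high (base x))" if x: "x \<in> ?S" for x
  proof -
    note b = F\<Delta>[OF base\<Delta>(1)[OF x]]
    have pos: "0 < 1 + ratio * low x" using ratio_pos low_nonneg[OF x] by (simp add: add_pos_nonneg)
    show "H x \<in> Eucl m" using b(1) by (simp add: H_def)
    show gH: "g (H x) = 1 + ratio * low x" 
      using radialD(2)[OF g b(1), of "1 + ratio * low x"] pos b(2) by (simp add: H_def)
    have "scale (1 / g (H x)) (H x) = F (\<phi> (base x))"
      unfolding gH using pos by (simp add: H_def fun_eq_iff)
    moreover have "\<psi> (G (F (\<phi> (base x)))) = high (base x)"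
      using G base\<Delta>[OF x] X(2) \<psi>_\<phi> base_in[OF x] by auto
    ultimately show "g' (H x) = (1 + ratio * low x) / (1 + high (base x))"
      by (simp add: g'_def gH)
  qed
  have g'H_le: "g' (H x) \<le> 1" and g'H_eq: "g' (H x) = 1 \<longleftrightarrow> x \<in> ?A" if x: "x \<in> ?S" for x
  proof -
    have "0 < 1 + (high x + ratio * low x)"
      using ratio_pos low_nonneg[OF x] high_nonneg[OF x] by (simp add: add_pos_nonneg)
    then show "g' (H x) \<le> 1" "g' (H x) = 1 \<longleftrightarrow> x \<in> ?A"
      unfolding H(3)[OF x] high_base using high_nonneg[OF x] high_zero_iff[OF x] x
      by (auto simp: divide_le_eq_1)
  qed
  have HB: "H x = F (\<phi> x)" if "x \<in> ?B" for x
    using that B_low[OF that] base_id by (simp add: H_def)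
  have F'\<phi>: "F' (\<phi> x) = H x" if x: "x \<in> ?S" for x
    using meet[OF x] HB[of x] x by (auto simp: F'_def \<xi>)
  have F'X: "F' y = F y" if "y \<in> X" for y using that by (simp add: F'_def)
  have g'_le: "g' z \<le> g z" if "z \<in> Eucl m" for z
  proof -
    have "?s (scale (1 / g z) z) \<le> 1"
      using \<psi>_nonneg[of "G (scale (1 / g z) z)"] by (simp add: divide_le_eq_1)
    then show ?thesis unfolding g'_def using radialD(5)[OF g that] by (rule mult_left_le)
  qed
  have onto: "z \<in> F' ` (X \<union> \<phi> ` ?S)" if z: "z \<in> Eucl m" "g' z \<le> 1" for z
  proof (cases "g z \<le> 1")
    case True
    then have "z \<in> F ` X" using F(3) z by simp
    then show ?thesis using F'X by force
  next
    case False
    define u where "u = scale (1 / g z) z"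
    have "z \<noteq> (\<lambda>_. 0)" using False radialD(4)[OF g] by (metis zero_le_one)
    then have u: "u \<in> Eucl m" "g u = 1"
      using radial_normalize[OF g z(1)] by (simp_all add: u_def)
    have "g z * ?s u \<le> 1" using z(2) unfolding g'_def u_def .
    then have "g z \<le> 1 + \<psi> (G u)"
      using \<psi>_nonneg[of "G u"] by (simp add: divide_le_eq split: if_splits)
    then have "\<psi> (G u) \<noteq> 0" using False by auto
    then obtain b where b: "b \<in> ?B" "G u = \<phi> b" using G\<Delta>(1)[OF u] E(2) \<psi>_E by blast
    then have bS: "b \<in> ?S" "low b = 0" using B_low by auto
    have t: "0 \<le> g z - 1" "g z - 1 \<le> high b" using False \<open>g z \<le> 1 + \<psi> (G u)\<close> \<psi>_\<phi>[OF bS(1)] b(2) by auto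
    note l = lift[OF bS t]
    have "H (lift b (g z - 1)) = scale (g z) (F (\<phi> b))" using l by (simp add: H_def)
    also have "\<dots> = scale (g z) u" using b(2) G\<Delta>(2)[OF u] by simp
    also have "\<dots> = z" using False by (simp add: u_def)
    finally show ?thesis using F'\<phi>[OF l(1)] l(1) by (metis UnI2 image_eqI)
  qed
  show ?thesis
    unfolding ball_pair_def
  proof (intro conjI exI)
    show "compact (X \<union> \<phi> ` ?S)"
      using X(1) compact_continuous_image[OF \<phi>(1) compact_std_simplex] by (rule compact_Un)
    show "E \<union> \<phi> ` ?A \<subseteq> X \<union> \<phi> ` ?S" using E(2) X(2) by auto
    show "radial m g'" by (rule g')
    show "continuous_on (X \<union> \<phi> ` ?S) F'"
    proof (rule continuous_on_closed_Un[OF closedX closedL])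
      show "continuous_on X F'" by (rule continuous_on_eq[OF F(1)]) (simp add: F'X)
      have c1: "continuous_on ?S (\<lambda>x. \<phi> (base x))"
        by (rule continuous_on_compose2[OF \<phi>(1) continuous_base]) (use base_in in auto)
      have c2: "continuous_on ?S (\<lambda>x. F (\<phi> (base x)))"
        by (rule continuous_on_compose2[OF F(1) c1]) (use base\<Delta> X(2) in auto)
      have c3: "continuous_on ?S H"
        unfolding H_def
        by (intro continuous_on_coordinatewise_then_product continuous_on_mult continuous_on_add
            continuous_on_const continuous_low continuous_on_product_then_coordinatewise[OF c2])
      have "continuous_on (\<phi> ` ?S) (\<lambda>y. H (\<xi> y))"
        by (rule continuous_on_compose2[OF c3 \<xi>cont]) (auto simp: \<xi>)
      then show "continuous_on (\<phi> ` ?S) F'"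
        by (rule continuous_on_eq) (auto simp: \<xi> F'\<phi>)
    qed
    show "inj_on F' (X \<union> \<phi> ` ?S)"
    proof (rule inj_onI)
      \<comment> \<open>Points of the old body have radius at most 1 and points of the lens at least
        1; equality puts \<open>x\<close> on the patch.\<close>
      have mixed: "\<phi> x \<in> X" if "y \<in> X" "x \<in> ?S" "F y = H x" for x y
      proof -
        have "ratio * low x \<le> 0" using FX(2)[OF that(1)] H(2)[OF that(2)] that(3) by simp
        then have "low x = 0" using ratio_pos low_nonneg[OF that(2)] by (simp add: mult_le_0_iff)
        then show ?thesis using meet[OF that(2)] low_zero_iff[OF that(2)] by simp
      qed
      have LL: "x = x'" if "x \<in> ?S" "x' \<in> ?S" "H x = H x'" for x x'
      proof -
        have low: "low x = low x'" using H(2)[OF that(1)] H(2)[OF that(2)] that(3) ratio_pos by simp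
        have pos: "0 < 1 + ratio * low x'"
          using ratio_pos low_nonneg[OF that(2)] by (simp add: add_pos_nonneg)
        have "F (\<phi> (base x)) = F (\<phi> (base x'))"
        proof
          fix i
          have "(1 + ratio * low x) * F (\<phi> (base x)) i = (1 + ratio * low x') * F (\<phi> (base x')) i"
            using that(3) by (simp add: H_def fun_eq_iff)
          then show "F (\<phi> (base x)) i = F (\<phi> (base x')) i" using low pos by simp
        qed
        then have "\<phi> (base x) = \<phi> (base x')"
          using F(2) base\<Delta>(1) X(2) that by (meson inj_onD subsetD)
        then have "base x = base x'" using \<phi>(2) base_in that by (meson inj_onD)
        then show ?thesis using base_inj that low by blast
      qed
      fix y y' assume y: "y \<in> X \<union> \<phi> ` ?S" "y' \<in> X \<union> \<phi> ` ?S" "F' y = F' y'"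
      consider "y \<in> X" "y' \<in> X" | x where "y \<in> X" "y' \<notin> X" "x \<in> ?S" "y' = \<phi> x"
        | x where "y \<notin> X" "y' \<in> X" "x \<in> ?S" "y = \<phi> x"
        | x x' where "x \<in> ?S" "x' \<in> ?S" "y = \<phi> x" "y' = \<phi> x'"
        using y(1,2) by blast
      then show "y = y'"
      proof cases
        case 1
        then show ?thesis using y(3) F(2) by (simp add: F'X inj_onD)
      next
        case 2
        then show ?thesis using y(3) mixed[of y x] by (simp add: F'X F'\<phi>)
      next
        case 3
        then show ?thesis using y(3) mixed[of y' x] by (simp add: F'X F'\<phi>)
      next
        case 4
        then show ?thesis using y(3) LL[of x x'] by (simp add: F'\<phi>)
      qed
    qed
    show "F' ` (X \<union> \<phi> ` ?S) = {z \<in> Eucl m. g' z \<le> 1}"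
    proof (intro equalityI subsetI)
      fix z assume "z \<in> F' ` (X \<union> \<phi> ` ?S)"
      then consider y where "y \<in> X" "z = F y" | x where "x \<in> ?S" "z = H x"
        using F'X F'\<phi> by auto
      then show "z \<in> {z \<in> Eucl m. g' z \<le> 1}"
      proof cases
        case 1
        then show ?thesis using FX[of y] g'_le[of z] by simp
      next
        case 2
        then show ?thesis using H(1)[of x] g'H_le[of x] by simp
      qed
    qed (use onto in simp)
    show "F' ` (E \<union> \<phi> ` ?A) = {z \<in> Eucl m. g' z = 1}"
    proof (intro equalityI subsetI)
      fix z assume "z \<in> F' ` (E \<union> \<phi> ` ?A)"
      then consider y where "y \<in> E" "z = F' y" | x where "x \<in> ?A" "z = H x"
        using F'\<phi> by auto
      then show "z \<in> {z \<in> Eucl m. g' z = 1}"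
      proof cases
        case 1
        then have y: "y \<in> \<Delta>" "y \<in> X" "z = F y" using E(2) X(2) F'X by auto
        have "g' z = 1"
          using F\<Delta>[OF y(1)] G[OF y(2)] \<psi>_E[OF 1(1)] by (simp add: g'_def y(3))
        then show ?thesis using F\<Delta>[OF y(1)] y(3) by simp
      next
        case 2
        then show ?thesis using H(1)[of x] g'H_eq[of x] by simp
      qed
    next
      fix z assume z: "z \<in> {z \<in> Eucl m. g' z = 1}"
      then obtain y where y: "y \<in> X \<union> \<phi> ` ?S" "z = F' y" using onto[of z] by auto
      show "z \<in> F' ` (E \<union> \<phi> ` ?A)"
      proof (cases "y \<in> \<phi> ` ?S")
        case True
        then obtain x where x: "x \<in> ?S" "y = \<phi> x" by blast
        then have "x \<in> ?A" using z y(2) F'\<phi>[of x] g'H_eq[of x] by simp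
        then show ?thesis using x y(2) by blast
      next
        case False
        then have yX: "y \<in> X" "z = F y" using y F'X by auto
        \<comment> \<open>The gauge only decreases, so a point of the old body that is on the new
          boundary was on the old boundary.\<close>
        have "1 \<le> g z" using g'_le[of z] z by simp
        then have "g z = 1" using FX(2)[OF yX(1)] yX(2) by simp
        then have "z \<in> F ` \<Delta>" using F(4) z by simp
        then have "y \<in> \<Delta>" using yX F(2) X(2) by (auto dest: inj_onD)
        then have "y \<in> E" using E(2) False by auto
        then show ?thesis using y(2) by blast
      qed
    qed
  qed
qed

end

text \<open>The gauge of a simplex with barycentre at the origin and one barycentric coordinate
  eliminated. The \<open>Suc m\<close> linear forms have sum 0, so their maximum is positive unless
  all vanish; the factor \<open>Suc m\<close> normalizes the boundary to value 1.\<close>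

lemma radial_simplex:
  "radial m (\<lambda>z. real (Suc m) * Max ((\<lambda>i. if i < m then - z i else (\<Sum>j<m. z j)) ` {..<Suc m}))"
  unfolding radial_def
proof (intro conjI ballI allI impI)
  let ?w = "\<lambda>z i :: nat. if i < m then - z i else (\<Sum>j<m. z j) :: real"
  show "continuous_on (Eucl m) (\<lambda>z. real (Suc m) * Max (?w z ` {..<Suc m}))"
  proof (intro continuous_on_mult continuous_on_const continuous_on_Max)
    show "continuous_on (Eucl m) (\<lambda>z. ?w z i)" for i
      by (cases "i < m") (simp_all, (intro continuous_intros)+)
  qed auto
  show "real (Suc m) * Max (?w (scale a z) ` {..<Suc m}) = a * (real (Suc m) * Max (?w z ` {..<Suc m}))"
    if a: "0 \<le> a" for a z
  proof -
    have "mono (\<lambda>x. a * x)" using a by (intro monoI mult_left_mono)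
    then have "a * Max (?w z ` {..<Suc m}) = Max ((\<lambda>x. a * x) ` ?w z ` {..<Suc m})"
      by (intro mono_Max_commute) auto
    also have "(\<lambda>x. a * x) ` ?w z ` {..<Suc m} = ?w (scale a z) ` {..<Suc m}"
      unfolding image_image by (intro image_cong refl) (simp add: sum_distrib_left)
    finally show ?thesis by simp
  qed
  show "0 < real (Suc m) * Max (?w z ` {..<Suc m})" if z: "z \<in> Eucl m" "z \<noteq> (\<lambda>_. 0)" for z
  proof (rule ccontr)
    assume "\<not> ?thesis"
    then have "Max (?w z ` {..<Suc m}) \<le> 0" by (simp add: mult_less_0_iff not_less zero_less_mult_iff)
    then have le: "?w z i \<le> 0" if "i < Suc m" for i using that by (subst (asm) Max_le_iff) auto
    have nn: "0 \<le> z i" if "i < m" for i using le[of i] that by simp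
    have "(\<Sum>j<m. z j) = 0" using le[of m] nn by (intro antisym sum_nonneg) auto
    then have "z i = 0" if "i < m" for i using sum_nonneg_eq_0_iff[of "{..<m}" z] nn that by auto
    then have "z i = 0" for i using z(1) by (cases "i < m") auto
    then show False using z(2) by auto
  qed
qed

lemma ball_pair_simplex:
  fixes \<phi> :: "(nat \<Rightarrow> real) \<Rightarrow> 'p::t2_space"
  assumes d: "0 < d" and \<phi>: "continuous_on (std_simplex d) \<phi>" "inj_on \<phi> (std_simplex d)"
  shows "ball_pair (d - 1) (\<phi> ` std_simplex d) (\<phi> ` {x \<in> std_simplex d. \<exists>c\<in>{..<d}. x c = 0})"
proof -
  obtain m where m: "d = Suc m" using d by (cases d) auto
  let ?S = "std_simplex d" and ?B = "{x \<in> std_simplex d. \<exists>c\<in>{..<d}. x c = 0}"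
  define w where "w = (\<lambda>z i :: nat. if i < m then - z i else (\<Sum>j<m. z j) :: real)"
  define g where "g = (\<lambda>z. real (Suc m) * Max (w z ` {..<Suc m}))"
  have g: "radial m g" unfolding g_def w_def by (rule radial_simplex)
  \<comment> \<open>The barycentre, with all coordinates \<open>1 / d\<close>, goes to the origin
    and the last coordinate is dropped; then \<open>d * w (y x) i = 1 - d * x i\<close>.\<close>
  define y where "y = (\<lambda>x i :: nat. if i < m then x i - 1 / d else 0 :: real)"
  have wy: "w (y x) i = 1 / d - x i" if "x \<in> ?S" "i < d" for x i
  proof (cases "i < m")
    case False
    then have "i = m" using that m by simp
    moreover have "(\<Sum>j<m. x j) = 1 - x m" using std_simplexD(3)[OF that(1)] m by simp
    ultimately have "w (y x) i = 1 - x m - real m / d"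
      by (simp add: w_def y_def sum_subtractf)
    moreover have "1 - real m / d = 1 / d" using m by (simp add: field_simps)
    ultimately show ?thesis using \<open>i = m\<close> by simp
  qed (simp add: w_def y_def)
  have attained: "\<exists>i<d. g z = d * w z i" for z
  proof -
    have "Max (w z ` {..<Suc m}) \<in> w z ` {..<Suc m}" by (intro Max_in) auto
    then show ?thesis by (auto simp: g_def m)
  qed
  have upper: "d * w z i \<le> g z" if "i < d" for z i
    unfolding g_def m using that m by (intro mult_left_mono Max_ge) auto
  have wd: "real d * w (y x) i = 1 - real d * x i" if "x \<in> ?S" "i < d" for x :: "nat \<Rightarrow> real" and i
    using wy[OF that] d by (simp add: right_diff_distrib)
  have gy: "g (y x) \<le> 1" "g (y x) = 1 \<longleftrightarrow> x \<in> ?B" if x: "x \<in> ?S" for x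
  proof -
    obtain i where i: "i < d" "g (y x) = d * w (y x) i" using attained by blast
    show le: "g (y x) \<le> 1" using i wd[OF x i(1)] std_simplexD(1)[OF x, of i] by simp
    show "g (y x) = 1 \<longleftrightarrow> x \<in> ?B"
    proof
      assume "g (y x) = 1"
      then show "x \<in> ?B" using i wd[OF x i(1)] x d by auto
    next
      assume "x \<in> ?B"
      then obtain c where "c < d" "x c = 0" by auto
      then show "g (y x) = 1" using le upper[of c "y x"] wd[OF x, of c] by simp
    qed
  qed
  have onto: "\<exists>x\<in>?S. y x = z" if z: "z \<in> Eucl m" "g z \<le> 1" for z
  proof -
    define x where "x = (\<lambda>i. if i < d then 1 / d - w z i else 0)"
    have "0 \<le> x i" for i
      using upper[of i z] z(2) d by (auto simp: x_def field_simps)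
    moreover have "(\<Sum>i<d. x i) = 1"
      by (simp add: x_def m w_def sum.distrib) (simp add: field_simps)
    ultimately have "x \<in> ?S" by (auto simp: std_simplex_def x_def)
    moreover have "y x = z" using z(1) by (auto simp: y_def x_def w_def m fun_eq_iff)
    ultimately show ?thesis by blast
  qed
  have y_inj: "x = x'" if "x \<in> ?S" "x' \<in> ?S" "y x = y x'" for x x'
  proof
    fix i
    show "x i = x' i"
      using wy[OF that(1), of i] wy[OF that(2), of i] that by (cases "i < d") (auto simp: std_simplexD)
  qed
  have ycont: "continuous_on A y" for A
  proof (rule continuous_on_coordinatewise_then_product)
    fix i
    show "continuous_on A (\<lambda>x. y x i)"
      unfolding y_def by (cases "i < m") (simp_all, (intro continuous_intros)+)
  qed
  have yE: "y x \<in> Eucl m" for x by (simp add: y_def)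
  define \<xi> where "\<xi> = the_inv_into ?S \<phi>"
  have \<xi>: "\<xi> (\<phi> x) = x" if "x \<in> ?S" for x
    unfolding \<xi>_def using \<phi>(2) that by (rule the_inv_into_f_f)
  have \<xi>cont: "continuous_on (\<phi> ` ?S) \<xi>"
    by (rule continuous_on_inv[OF \<phi>(1) compact_std_simplex]) (simp add: \<xi>)
  show ?thesis
    unfolding ball_pair_def
  proof (intro conjI exI)
    show "compact (\<phi> ` ?S)" by (rule compact_continuous_image[OF \<phi>(1) compact_std_simplex])
    show "radial (d - 1) g" using g m by simp
    show "continuous_on (\<phi> ` ?S) (\<lambda>p. y (\<xi> p))"
      by (rule continuous_on_compose2[OF ycont[of UNIV] \<xi>cont]) auto
    show "inj_on (\<lambda>p. y (\<xi> p)) (\<phi> ` ?S)"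
    proof (rule inj_onI)
      fix p q assume pq: "p \<in> \<phi> ` ?S" "q \<in> \<phi> ` ?S" "y (\<xi> p) = y (\<xi> q)"
      then obtain x x' where x: "x \<in> ?S" "x' \<in> ?S" "p = \<phi> x" "q = \<phi> x'" by blast
      then have "y x = y x'" using pq(3) \<xi> by simp
      then show "p = q" using y_inj[of x x'] x by simp
    qed
    show "(\<lambda>p. y (\<xi> p)) ` \<phi> ` ?S = {z \<in> Eucl (d - 1). g z \<le> 1}"
    proof (intro equalityI subsetI)
      fix z assume "z \<in> {z \<in> Eucl (d - 1). g z \<le> 1}"
      then obtain x where "x \<in> ?S" "y x = z" using onto[of z] m by auto
      then show "z \<in> (\<lambda>p. y (\<xi> p)) ` \<phi> ` ?S" using \<xi>[of x] by (force simp: image_image)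
    qed (use gy yE m \<xi> in auto)
    show "(\<lambda>p. y (\<xi> p)) ` \<phi> ` ?B = {z \<in> Eucl (d - 1). g z = 1}"
    proof (intro equalityI subsetI)
      fix z assume z: "z \<in> {z \<in> Eucl (d - 1). g z = 1}"
      then obtain x where x: "x \<in> ?S" "y x = z" using onto[of z] m by auto
      then have "x \<in> ?B" using gy(2)[OF x(1)] z by blast
      then show "z \<in> (\<lambda>p. y (\<xi> p)) ` \<phi> ` ?B" using x \<xi>[of x] by (force simp: image_image)
    next
      fix z assume "z \<in> (\<lambda>p. y (\<xi> p)) ` \<phi> ` ?B"
      then obtain x where "x \<in> ?B" "z = y (\<xi> (\<phi> x))" by blast
      then show "z \<in> {z \<in> Eucl (d - 1). g z = 1}" using gy(2)[of x] yE[of x] m \<xi>[of x] by auto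
    qed
  qed auto
qed

section \<open>Glued complexes are balls\<close>

abbreviation supp :: "(nat \<Rightarrow> real) \<Rightarrow> nat set" where
  "supp x \<equiv> {c. x c \<noteq> 0}"

text \<open>The realization enters only through parametrizations \<open>pt k\<close> of its
  simplices and a rule for coincidence: equal coordinates and equal smallest face, the one coloured
  by the support. The induction carries along the description of the boundary by free
  facets.\<close>

lemma ball_pair_glued:
  fixes pt :: "nat \<Rightarrow> (nat \<Rightarrow> real) \<Rightarrow> 'p::t2_space"
  assumes "glued d gs" "0 < d"
    and "\<And>k. k < length gs \<Longrightarrow> continuous_on (std_simplex d) (pt k)"
    and "\<And>j k x y. j < length gs \<Longrightarrow> k < length gs \<Longrightarrow> x \<in> std_simplex d \<Longrightarrow> y \<in> std_simplex d \<Longrightarrow>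
      pt j x = pt k y \<longleftrightarrow> x = y \<and> rep (supp x) gs j = rep (supp x) gs k"
  shows "ball_pair (d - 1) (\<Union>k<length gs. pt k ` std_simplex d)
    (\<Union>(j, c)\<in>free_facets d gs. pt j ` {x \<in> std_simplex d. x c = 0})"
  using assms(1,3,4)
proof (induction rule: glued.induct)
  case single
  have "inj_on (pt 0) (std_simplex d)" using single(2)[of 0 0] by (auto intro!: inj_onI)
  then have "ball_pair (d - 1) (pt 0 ` std_simplex d) (pt 0 ` {x \<in> std_simplex d. \<exists>c\<in>{..<d}. x c = 0})"
    using single(1)[of 0] assms(2) by (intro ball_pair_simplex) auto
  moreover have "(\<Union>(j, c)\<in>free_facets d [Map.empty]. pt j ` {x \<in> std_simplex d. x c = 0}) =
      pt 0 ` {x \<in> std_simplex d. \<exists>c\<in>{..<d}. x c = 0}"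
    by auto
  ultimately show ?case by (simp add: lessThan_Suc)
next
  case (attach gs g)
  let ?S = "std_simplex d" and ?k = "length gs" and ?T = "dom g"
  let ?X = "\<Union>k<length gs. pt k ` ?S" and ?F = "\<lambda>j c. pt j ` {x \<in> ?S. x c = 0}"
  let ?\<Delta> = "\<Union>(j, c)\<in>free_facets d gs. ?F j c"
  let ?E = "\<Union>(j, c)\<in>{(j, c) \<in> free_facets d gs. g c \<noteq> Some j}. ?F j c"
  interpret lens d ?T using attach.hyps by unfold_locales auto
  have gl: "glued d (g # gs)" using attach.hyps by (intro glued.attach)
  note eq = attach.prems(2)
  have eq': "pt j x = pt i y \<longleftrightarrow> x = y \<and> rep (supp x) gs j = rep (supp x) gs i"
    if "j < ?k" "i < ?k" "x \<in> ?S" "y \<in> ?S" for j i x y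
    using eq[of j i x y] that by simp
  have ball: "ball_pair (d - 1) ?X ?\<Delta>"
    using attach.prems(1) eq' by (intro attach.IH) auto
  have gc: "the (g c) < ?k" "(the (g c), c) \<in> free_facets d gs" if "c \<in> ?T" for c
    using gluableD_less[OF attach.hyps(4) that] gluableD_free[OF attach.hyps(4) that] .
  have rep_k: "rep S (g # gs) ?k = rep S gs (the (g c))" if "c \<in> ?T" "c \<notin> S" for c S
    using rep_Cons_length[OF attach.hyps(1,4), of c S] that by simp
  have pt_k: "pt ?k x = pt (the (g c)) x" if "x \<in> ?S" "c \<in> ?T" "x c = 0" for x c
    using eq[of ?k "the (g c)" x x] gc[of c] rep_k[of c "supp x"] that by simp
  have cont: "continuous_on ?S (pt ?k)" using attach.prems(1)[of ?k] by simp
  have inj: "inj_on (pt ?k) ?S" using eq[of ?k ?k] by (auto intro!: inj_onI)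
  have meet: "pt ?k x \<in> ?X \<longleftrightarrow> (\<exists>c\<in>?T. x c = 0)" if x: "x \<in> ?S" for x
  proof
    assume "pt ?k x \<in> ?X"
    then obtain j y where j: "j < ?k" "y \<in> ?S" "pt ?k x = pt j y" by blast
    have "pt ?k x = pt j y \<longleftrightarrow> x = y \<and> rep (supp x) (g # gs) ?k = rep (supp x) (g # gs) j"
      using j x by (intro eq) auto
    then have "rep (supp x) (g # gs) ?k = rep (supp x) (g # gs) j" using j(3) by blast
    also have "\<dots> = rep (supp x) gs j" using j(1) by simp
    also have "\<dots> < ?k" by (rule rep_less[OF attach.hyps(1) j(1)])
    finally have "\<not> ?T \<subseteq> supp x" using rep_Cons_length_subset[of g "supp x" gs] by auto
    then show "\<exists>c\<in>?T. x c = 0" by blast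
  next
    assume "\<exists>c\<in>?T. x c = 0"
    then obtain c where "c \<in> ?T" "x c = 0" by blast
    then show "pt ?k x \<in> ?X" using pt_k[OF x] gc[of c] x by auto
  qed
  have closedF: "closed (?F j c)" if "(j, c) \<in> free_facets d gs" for j c
  proof -
    have "compact {x \<in> ?S. x c = 0}" using compact_std_simplex_faces[of "{c}" d] by simp
    moreover have "continuous_on {x \<in> ?S. x c = 0} (pt j)"
      using attach.prems(1)[of j] free_facetsD[OF that] by (auto intro: continuous_on_subset)
    ultimately show ?thesis by (intro compact_imp_closed compact_continuous_image)
  qed
  have E: "closed ?E"
    by (intro closed_UN finite_subset[OF _ finite_free_facets[of d gs]]) (use closedF in auto)
  have \<Delta>: "?\<Delta> = ?E \<union> pt ?k ` {x \<in> ?S. \<exists>c\<in>?T. x c = 0}"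
  proof (intro equalityI subsetI)
    fix p assume "p \<in> ?\<Delta>"
    then obtain j c x where p: "(j, c) \<in> free_facets d gs" "x \<in> ?S" "x c = 0" "p = pt j x" by blast
    show "p \<in> ?E \<union> pt ?k ` {x \<in> ?S. \<exists>c\<in>?T. x c = 0}"
    proof (cases "g c = Some j")
      case True
      then have c: "c \<in> ?T" by auto
      then have "p = pt ?k x" using pt_k[OF p(2) c p(3)] True p(4) by simp
      then show ?thesis using p c by blast
    qed (use p in blast)
  next
    fix p assume "p \<in> ?E \<union> pt ?k ` {x \<in> ?S. \<exists>c\<in>?T. x c = 0}"
    then show "p \<in> ?\<Delta>"
    proof
      assume "p \<in> pt ?k ` {x \<in> ?S. \<exists>c\<in>?T. x c = 0}"
      then obtain x c where "x \<in> ?S" "c \<in> ?T" "x c = 0" "p = pt ?k x" by blast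
      then show ?thesis using pt_k[of x c] gc(2)[of c] by blast
    qed blast
  qed
  \<comment> \<open>If \<open>x\<close> avoided all facets of the new simplex with colours outside
    \<open>?T\<close>, its smallest face would be interior to the patch. By \<open>gluable\<close>,
    a free facet of colour \<open>c\<close> containing that face is the one glued, which
    \<open>?E\<close> excludes.\<close>
  have EB: "\<exists>c\<in>{..<d} - ?T. x c = 0" if x: "x \<in> ?S" and pE: "pt ?k x \<in> ?E" for x
  proof (rule ccontr)
    assume "\<not> ?thesis"
    then have U: "{..<d} - supp x \<subseteq> ?T" by blast
    obtain j c where j: "(j, c) \<in> free_facets d gs" "g c \<noteq> Some j" "x c = 0" "pt ?k x = pt j x"
    proof -
      obtain j c y where j: "(j, c) \<in> free_facets d gs" "g c \<noteq> Some j" "y \<in> ?S" "y c = 0" "pt ?k x = pt j y"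
        using pE by blast
      then have "x = y" using eq[of ?k j x y] x free_facetsD[OF j(1)] by simp
      then show ?thesis using that j by blast
    qed
    have c: "c \<in> {..<d} - supp x" using free_facetsD[OF j(1)] j(3) by simp
    then have cT: "c \<in> ?T" using U by blast
    have "rep (supp x) gs j = rep (supp x) gs (the (g c))"
      using eq[of ?k j x x] x j(4) free_facetsD[OF j(1)] rep_k[OF cT, of "supp x"] c by simp
    then have "j = the (g c)"
      using gluableD_iff[OF attach.hyps(4) U c c j(1)] by blast
    then show False using j(2) cT by auto
  qed
  have "ball_pair (d - 1) (?X \<union> pt ?k ` ?S) (?E \<union> pt ?k ` {x \<in> ?S. \<exists>c\<in>{..<d} - ?T. x c = 0})"
    by (rule ball_pair_attach[OF ball cont inj meet E \<Delta> EB])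
  moreover have "?X \<union> pt ?k ` ?S = (\<Union>k<length (g # gs). pt k ` ?S)"
    by (simp add: lessThan_Suc Un_commute)
  moreover have "(\<Union>(j, c)\<in>{?k} \<times> ({..<d} - ?T). ?F j c) = pt ?k ` {x \<in> ?S. \<exists>c\<in>{..<d} - ?T. x c = 0}"
    by auto
  then have "?E \<union> pt ?k ` {x \<in> ?S. \<exists>c\<in>{..<d} - ?T. x c = 0} =
      (\<Union>(j, c)\<in>free_facets d (g # gs). ?F j c)"
    by (simp only: free_facets.simps UN_Un)
  ultimately show ?case by simp
qed

section \<open>Chain decompositions and the face poset\<close>

text \<open>\<open>x\<close> as a nonnegative combination of indicator functions along a chain of
  nonempty sets: this locates a point in the barycentric subdivision of a simplex.\<close>

definition chain_decomp :: "nat set \<Rightarrow> (nat \<Rightarrow> real) \<Rightarrow> (nat set \<Rightarrow> real) \<Rightarrow> bool" where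
  "chain_decomp C x u \<longleftrightarrow> (\<forall>S. 0 \<le> u S) \<and> (\<forall>S. u S \<noteq> 0 \<longrightarrow> S \<subseteq> C \<and> S \<noteq> {}) \<and>
     (\<forall>S S'. u S \<noteq> 0 \<and> u S' \<noteq> 0 \<longrightarrow> S \<subseteq> S' \<or> S' \<subseteq> S) \<and>
     (\<forall>c\<in>C. x c = (\<Sum>S\<in>Pow C. if c \<in> S then u S else 0))"

lemma chain_decompD:
  assumes "chain_decomp C x u"
  shows "0 \<le> u S" "u S \<noteq> 0 \<Longrightarrow> S \<subseteq> C" "u S \<noteq> 0 \<Longrightarrow> S \<noteq> {}"
    "u S \<noteq> 0 \<Longrightarrow> u S' \<noteq> 0 \<Longrightarrow> S \<subseteq> S' \<or> S' \<subseteq> S"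
    "c \<in> C \<Longrightarrow> x c = (\<Sum>S\<in>Pow C. if c \<in> S then u S else 0)"
  using assms unfolding chain_decomp_def by blast+

lemma chain_decomp_le:
  assumes "finite C" "chain_decomp C x u" "c \<in> C" "c \<in> S" "u S \<noteq> 0"
  shows "0 < u S" "u S \<le> x c"
proof -
  show "0 < u S" using chain_decompD(1)[OF assms(2), of S] assms(5) by simp
  have "(if c \<in> S then u S else 0) \<le> (\<Sum>S\<in>Pow C. if c \<in> S then u S else 0)"
    using chain_decompD(1,2)[OF assms(2)] assms by (intro member_le_sum) auto
  then show "u S \<le> x c" using chain_decompD(5)[OF assms(2,3)] assms(4) by simp
qed

lemma finite_chain_max:
  assumes "finite A" "A \<noteq> {}" "\<And>S S'. S \<in> A \<Longrightarrow> S' \<in> A \<Longrightarrow> S \<subseteq> S' \<or> S' \<subseteq> S"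
  shows "\<exists>M\<in>A. \<forall>S\<in>A. S \<subseteq> M"
  using assms
proof (induction A rule: finite_ne_induct)
  case (insert S A)
  have "\<exists>M\<in>A. \<forall>S\<in>A. S \<subseteq> M" by (rule insert.IH) (rule insert.prems; blast)
  then obtain M where "M \<in> A" "\<forall>S\<in>A. S \<subseteq> M" by blast
  then show ?case using insert.prems[of S M] by (cases "S \<subseteq> M") auto
qed simp

text \<open>The largest set in the decomposition is the support of \<open>x\<close>; its coefficient is the minimum of
  \<open>x\<close> there, attained at a point that lies in no other set of the chain.\<close>
lemma chain_decomp_top:
  assumes C: "finite C" and u: "chain_decomp C x u" and x: "\<exists>c\<in>C. x c \<noteq> 0"
  defines "A \<equiv> {c \<in> C. x c \<noteq> 0}"
  shows "u A = Min (x ` A)"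
proof -
  let ?U = "{S. u S \<noteq> 0}"
  have fin: "finite ?U" using chain_decompD(2)[OF u] C by (intro finite_subset[of ?U "Pow C"]) auto
  have in_U: "\<exists>S\<in>?U. c \<in> S" if "c \<in> A" for c
  proof (rule ccontr)
    assume "\<not> ?thesis"
    then have "(\<Sum>S\<in>Pow C. if c \<in> S then u S else 0) = 0" by (intro sum.neutral) auto
    then show False using that chain_decompD(5)[OF u, of c] by (simp add: A_def)
  qed
  have sub: "S \<subseteq> A" if "u S \<noteq> 0" for S
    using chain_decomp_le[OF C u, of _ S] chain_decompD(2)[OF u that] that by (fastforce simp: A_def)
  have "?U \<noteq> {}" using in_U x by (fastforce simp: A_def)
  then obtain M where M: "u M \<noteq> 0" "\<And>S. u S \<noteq> 0 \<Longrightarrow> S \<subseteq> M"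
    using finite_chain_max[OF fin] chain_decompD(4)[OF u] by (metis (mono_tags, lifting) mem_Collect_eq)
  have "M = A" using in_U M sub by blast
  then have A: "u A \<noteq> 0" using M by simp
  obtain c where c: "c \<in> A" "\<And>S. u S \<noteq> 0 \<Longrightarrow> S \<noteq> A \<Longrightarrow> c \<notin> S"
  proof (cases "?U - {A} = {}")
    case True
    then show ?thesis using that x by (fastforce simp: A_def)
  next
    case False
    then obtain M' where "M' \<in> ?U - {A}" "\<And>S. S \<in> ?U - {A} \<Longrightarrow> S \<subseteq> M'"
      using finite_chain_max[of "?U - {A}"] fin chain_decompD(4)[OF u] by (metis (mono_tags, lifting) DiffD1 finite_Diff mem_Collect_eq)
    moreover from this obtain c where "c \<in> A" "c \<notin> M'" using sub by blast
    ultimately show ?thesis using that[of c] by blast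
  qed
  have "A \<in> Pow C" by (auto simp: A_def)
  have "x c = (\<Sum>S\<in>Pow C. if c \<in> S then u S else 0)" using c chain_decompD(5)[OF u] by (simp add: A_def)
  also have "\<dots> = (\<Sum>S\<in>Pow C. if S = A then u S else 0)"
    using c by (intro sum.cong) auto
  also have "\<dots> = u A" using C \<open>A \<in> Pow C\<close> by simp
  finally have "u A \<in> x ` A" using c(1) by force
  moreover have "u A \<le> x c'" if "c' \<in> A" for c'
    using chain_decomp_le(2)[OF C u, of c' A] A that by (simp add: A_def)
  ultimately show ?thesis using C by (intro Min_eqI[symmetric]) (auto simp: A_def)
qed

lemma sum_chain_upd:
  assumes "finite C" "A \<in> Pow C"
  shows "(\<Sum>S\<in>Pow C. if c \<in> S then (u(A := v)) S else 0) =
    (\<Sum>S\<in>Pow C. if c \<in> S then u S else 0) + (if c \<in> A then v - u A else 0 :: real)"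
proof -
  have "(\<Sum>S\<in>Pow C. if c \<in> S then (u(A := v)) S else 0) =
      (\<Sum>S\<in>Pow C. (if c \<in> S then u S else 0) + (if S = A then (if c \<in> A then v - u A else 0) else 0))"
    by (intro sum.cong) auto
  then show ?thesis using assms by (simp add: sum.distrib)
qed

text \<open>Subtract the minimum over the support from the support and recurse. The second conjunct
  serves the induction: it shows that the sets found later are proper subsets of the current
  support.\<close>

lemma chain_decomp_exists:
  assumes C: "finite C" and x: "\<And>c. 0 \<le> x c"
  shows "\<exists>u. chain_decomp C x u \<and> (\<forall>S. u S \<noteq> 0 \<longrightarrow> S \<subseteq> {c. x c \<noteq> 0})"
  using x
proof (induction "card {c \<in> C. x c \<noteq> 0}" arbitrary: x rule: less_induct)
  case less
  let ?A = "{c \<in> C. x c \<noteq> 0}"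
  show ?case
  proof (cases "?A = {}")
    case True
    then show ?thesis by (intro exI[of _ "\<lambda>_. 0"]) (auto simp: chain_decomp_def)
  next
    case False
    define m where "m = Min (x ` ?A)"
    define y where "y = (\<lambda>c. if c \<in> ?A then x c - m else x c)"
    have "m \<in> x ` ?A" unfolding m_def using False C by (intro Min_in) auto
    then obtain a where a: "a \<in> ?A" "m = x a" by auto
    have m_le: "m \<le> x c" if "c \<in> ?A" for c unfolding m_def using that C by (intro Min_le) auto
    have m: "0 < m" using a less.prems[of a] by auto
    have y: "0 \<le> y c" for c using m_le[of c] less.prems[of c] by (auto simp: y_def)
    have sub: "{c \<in> C. y c \<noteq> 0} \<subset> ?A" using a by (auto simp: y_def)
    then have "card {c \<in> C. y c \<noteq> 0} < card ?A" using C by (intro psubset_card_mono) auto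
    then obtain u where u: "chain_decomp C y u" "\<And>S. u S \<noteq> 0 \<Longrightarrow> S \<subseteq> {c. y c \<noteq> 0}"
      using less.hyps[of y] y by blast
    have "a \<notin> {c. y c \<noteq> 0}" using a by (simp add: y_def)
    then have uA: "u ?A = 0" using u(2)[of ?A] a(1) by blast
    have supp: "S \<subseteq> ?A" if "u S \<noteq> 0" for S
      using u(2)[OF that] chain_decompD(2)[OF u(1) that] by (auto simp: y_def split: if_splits)
    have "chain_decomp C x (u(?A := m))"
      unfolding chain_decomp_def
    proof (intro conjI allI impI ballI)
      show "0 \<le> (u(?A := m)) S" for S using m chain_decompD(1)[OF u(1)] by simp
      show "S \<subseteq> C" "S \<noteq> {}" if "(u(?A := m)) S \<noteq> 0" for S
        using that chain_decompD(2,3)[OF u(1), of S] False by (auto split: if_splits)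
      show "S \<subseteq> S' \<or> S' \<subseteq> S" if "(u(?A := m)) S \<noteq> 0 \<and> (u(?A := m)) S' \<noteq> 0" for S S'
        using that chain_decompD(4)[OF u(1), of S S'] supp[of S] supp[of S'] by (auto split: if_splits)
      show "x c = (\<Sum>S\<in>Pow C. if c \<in> S then (u(?A := m)) S else 0)" if c: "c \<in> C" for c
      proof -
        have "?A \<in> Pow C" by auto
        note eq = sum_chain_upd[OF C this, of c u m] chain_decompD(5)[OF u(1) c]
        show ?thesis by (simp only: eq(1) eq(2)[symmetric] uA) (simp add: y_def)
      qed
    qed
    moreover have "S \<subseteq> {c. x c \<noteq> 0}" if "(u(?A := m)) S \<noteq> 0" for S
      using that supp[of S] by (auto split: if_splits)
    ultimately show ?thesis by blast
  qed
qed

text \<open>\<open>chain_decomp_top\<close> forces the coefficient of the support; removing this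
  term leaves a decomposition of a vector with smaller support.\<close>

lemma chain_decomp_unique:
  assumes C: "finite C" and "chain_decomp C x u" "chain_decomp C x v"
  shows "u = v"
  using assms(2,3)
proof (induction "card {c \<in> C. x c \<noteq> 0}" arbitrary: x u v rule: less_induct)
  case less
  let ?A = "{c \<in> C. x c \<noteq> 0}"
  show ?case
  proof (cases "?A = {}")
    case True
    have zero: "w S = 0" if w: "chain_decomp C x w" for w S
    proof (rule ccontr)
      assume S: "w S \<noteq> 0"
      then obtain c where "c \<in> S" "c \<in> C" using chain_decompD(2,3)[OF w S] by blast
      then show False using chain_decomp_le[OF C w _ _ S] True by force
    qed
    show ?thesis by (rule ext) (simp only: zero[OF less.prems(1)] zero[OF less.prems(2)])
  next
    case False
    define m where "m = Min (x ` ?A)"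
    define y where "y = (\<lambda>c. if c \<in> ?A then x c - m else x c)"
    have "m \<in> x ` ?A" unfolding m_def using False C by (intro Min_in) auto
    then obtain a where a: "a \<in> ?A" "m = x a" by auto
    have "{c \<in> C. y c \<noteq> 0} \<subset> ?A" using a by (auto simp: y_def)
    then have less': "card {c \<in> C. y c \<noteq> 0} < card ?A" using C by (intro psubset_card_mono) auto
    have y: "chain_decomp C y (w(?A := 0))" and w: "w ?A = m" if w: "chain_decomp C x w" for w
    proof -
      show wA: "w ?A = m" unfolding m_def using chain_decomp_top[OF C w] False by blast
      show "chain_decomp C y (w(?A := 0))"
        unfolding chain_decomp_def
      proof (intro conjI allI impI ballI)
        show "y c = (\<Sum>S\<in>Pow C. if c \<in> S then (w(?A := 0)) S else 0)" if c: "c \<in> C" for c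
        proof -
          have "?A \<in> Pow C" by auto
          note eq = sum_chain_upd[OF C this, of c w 0] chain_decompD(5)[OF w c]
          show ?thesis by (simp only: eq(1) eq(2)[symmetric] wA) (simp add: y_def)
        qed
      qed (use chain_decompD[OF w] in \<open>auto split: if_splits\<close>)
    qed
    have "u(?A := 0) = v(?A := 0)"
      using less.hyps[OF less' y[OF less.prems(1)] y[OF less.prems(2)]] .
    note eq = fun_cong[OF this]
    show ?thesis
    proof
      fix S
      show "u S = v S"
        using eq[of S] w[OF less.prems(1)] w[OF less.prems(2)] by (cases "S = ?A") simp_all
    qed
  qed
qed

section \<open>Faces coded as numbers, and the poset they form\<close>

definition face :: "nat set \<Rightarrow> nat \<Rightarrow> nat" where "face S r = prod_encode (set_encode S, r)"
definition col :: "nat \<Rightarrow> nat set" where "col p = set_decode (fst (prod_decode p))"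
definition idx :: "nat \<Rightarrow> nat" where "idx p = snd (prod_decode p)"

lemma col_face [simp]: "finite S \<Longrightarrow> col (face S r) = S"
  by (simp add: col_def face_def)

lemma idx_face [simp]: "idx (face S r) = r"
  by (simp add: idx_def face_def)

lemma face_col_idx [simp]: "face (col p) (idx p) = p"
  by (simp add: col_def idx_def face_def)

lemma finite_col [simp]: "finite (col p)"
  by (simp add: col_def)

lemma face_eqI: "col p = col q \<Longrightarrow> idx p = idx q \<Longrightarrow> p = q"
  by (metis face_col_idx)

locale glued_complex =
  fixes d :: nat and gs :: "(nat \<rightharpoonup> nat) list"
  assumes glued: "glued d gs" and d: "0 < d"
begin

text \<open>Every simplex containing a face could name it; fixed points of \<open>rep\<close> select
  exactly one code.\<close>

definition faces :: "nat set" where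
  "faces = {p. col p \<subseteq> {..<d} \<and> idx p < length gs \<and> rep (col p) gs (idx p) = idx p}"

definition face_le :: "nat \<Rightarrow> nat \<Rightarrow> bool" where
  "face_le p q \<longleftrightarrow> col p \<subseteq> col q \<and> rep (col p) gs (idx q) = idx p"

abbreviation bottom :: nat where "bottom \<equiv> face {} 0"

definition cell :: "nat \<Rightarrow> nat set \<Rightarrow> nat" where "cell k S = face S (rep S gs k)"

lemma rep_rep': "S \<subseteq> S' \<Longrightarrow> rep S gs (rep S' gs k) = rep S gs k"
  by (rule rep_rep(1)[OF glued])

lemma facesD: "p \<in> faces \<Longrightarrow> col p \<subseteq> {..<d}" "p \<in> faces \<Longrightarrow> idx p < length gs"
    "p \<in> faces \<Longrightarrow> rep (col p) gs (idx p) = idx p"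
  by (auto simp: faces_def)

lemma face_leD: "face_le p q \<Longrightarrow> col p \<subseteq> col q" "face_le p q \<Longrightarrow> rep (col p) gs (idx q) = idx p"
  by (auto simp: face_le_def)

lemma cell_in: "S \<subseteq> {..<d} \<Longrightarrow> k < length gs \<Longrightarrow> cell k S \<in> faces"
  using rep_less[OF glued] by (auto simp: cell_def faces_def rep_rep' finite_subset)

lemma rep_full: "k < length gs \<Longrightarrow> rep {..<d} gs k = k"
  using rep_eq_iff[OF glued] glued_dom[OF glued] by simp

lemma finite_faces: "finite faces"
proof (rule finite_subset)
  show "faces \<subseteq> (\<lambda>(S, r). face S r) ` (Pow {..<d} \<times> {..<length gs})"
  proof
    fix p assume "p \<in> faces"
    then show "p \<in> (\<lambda>(S, r). face S r) ` (Pow {..<d} \<times> {..<length gs})"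
      using facesD by (intro image_eqI[of _ _ "(col p, idx p)"]) auto
  qed
qed auto

lemma bottom_in: "bottom \<in> faces"
  using glued_length[OF glued] rep_empty[OF glued] by (auto simp: faces_def)

lemma bottom_le: "p \<in> faces \<Longrightarrow> face_le bottom p"
  using rep_empty[OF glued] facesD by (auto simp: face_le_def)

lemma col_empty_iff: "p \<in> faces \<Longrightarrow> col p = {} \<longleftrightarrow> p = bottom"
proof
  assume p: "p \<in> faces" "col p = {}"
  then have "idx p = 0" using rep_empty[OF glued, of "idx p"] facesD[of p] by simp
  with p(2) show "p = bottom" by (metis face_col_idx)
qed simp

lemma face_le_antisym: "p \<in> faces \<Longrightarrow> q \<in> faces \<Longrightarrow> face_le p q \<Longrightarrow> col q \<subseteq> col p \<Longrightarrow> p = q"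
  using facesD(3)[of q] face_leD[of p q] by (metis face_eqI subset_antisym)

lemma face_le_trans: "face_le p q \<Longrightarrow> face_le q r \<Longrightarrow> face_le p r"
  using rep_rep'[of "col p" "col q" "idx r"] unfolding face_le_def by auto

lemma finite_poset: "finite_poset_with_min faces face_le bottom"
  unfolding finite_poset_with_min_def
proof (intro conjI ballI impI)
  show "face_le p p" if "p \<in> faces" for p using facesD(3)[OF that] by (simp add: face_le_def)
  show "p = q" if "p \<in> faces" "q \<in> faces" "face_le p q \<and> face_le q p" for p q
    using face_le_antisym[OF that(1,2)] face_leD(1)[of q p] that(3) by blast
  show "face_le p r" if "face_le p q \<and> face_le q r" for p q r using face_le_trans that by blast
qed (use finite_faces bottom_in bottom_le in simp_all)

lemma face_le_below:
  assumes "face_le q p" "face_le r p"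
  shows "face_le q r \<longleftrightarrow> col q \<subseteq> col r"
  using assms rep_rep'[of "col q" "col r" "idx p"] unfolding face_le_def by auto

lemma face_le_eq_cell: "face_le q p \<Longrightarrow> q = cell (idx p) (col q)"
  by (auto simp: face_le_def cell_def)

lemma cell_le: "p \<in> faces \<Longrightarrow> S \<subseteq> col p \<Longrightarrow> face_le (cell (idx p) S) p"
  using finite_subset[OF _ finite_col[of p]] by (auto simp: face_le_def cell_def)

text \<open>Below a fixed face the colours determine a face, although globally many faces may have
  the same colours.\<close>

lemma bij_col: 
  assumes p: "p \<in> faces"
  shows "bij_betw col (closed_interval faces face_le bottom p) (Pow (col p))"
proof (rule bij_betw_byWitness[where f' = "cell (idx p)"])
  show "cell (idx p) ` Pow (col p) \<subseteq> closed_interval faces face_le bottom p"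
    using cell_in cell_le[OF p] facesD(1,2)[OF p] bottom_le by (force simp: closed_interval_def)
  show "\<forall>S\<in>Pow (col p). col (cell (idx p) S) = S"
    using finite_subset[OF _ finite_col[of p]] by (auto simp: cell_def)
qed (auto simp: closed_interval_def face_le_def cell_def)

lemma boolean_of_rank_iff:
  assumes p: "p \<in> faces"
  shows "boolean_of_rank faces face_le bottom p k \<longleftrightarrow> k = card (col p)"
proof
  assume "boolean_of_rank faces face_le bottom p k"
  then obtain S :: "nat set" and g where "finite S" "card S = k"
    "bij_betw g (closed_interval faces face_le bottom p) (Pow S)"
    unfolding boolean_of_rank_def by blast
  then have "(2::nat) ^ k = 2 ^ card (col p)"
    using bij_betw_same_card[OF bij_col[OF p]] bij_betw_same_card by (fastforce simp: card_Pow)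
  then show "k = card (col p)" by simp
next
  assume "k = card (col p)"
  then show "boolean_of_rank faces face_le bottom p k"
    unfolding boolean_of_rank_def
    using bij_col[OF p] face_le_below[of _ p]
    by (intro exI[of _ "col p"] exI[of _ col]) (auto simp: closed_interval_def)
qed

lemma simplicial: "simplicial_poset faces face_le bottom"
  unfolding simplicial_poset_def using finite_poset boolean_of_rank_iff by blast

lemma fnum_eq: "fnum faces face_le bottom i = card {p \<in> faces. card (col p) = i}"
  unfolding fnum_def by (rule arg_cong[where f = card]) (auto simp: boolean_of_rank_iff)

lemma card_col_le: "p \<in> faces \<Longrightarrow> card (col p) \<le> d"
  using card_mono[OF _ facesD(1)] by fastforce

lemma dim: "has_dim faces face_le bottom d"
proof -
  have "cell 0 {..<d} \<in> {p \<in> faces. card (col p) = d}"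
    using cell_in[of "{..<d}" 0] glued_length[OF glued] by (simp add: cell_def)
  then have "card {p \<in> faces. card (col p) = d} \<noteq> 0" using finite_faces by (auto simp: card_eq_0_iff)
  moreover have "card {p \<in> faces. card (col p) = i} = 0" if "d < i" for i
  proof -
    have "{p \<in> faces. card (col p) = i} = {}" using card_col_le that by force
    then show ?thesis by (simp only: card.empty)
  qed
  ultimately show ?thesis unfolding has_dim_def fnum_eq by blast
qed

end

section \<open>The realization of the face poset\<close>

context glued_complex begin

text \<open>By \<open>rep_eq_iff\<close>, the faces first occurring in simplex \<open>r\<close> form
  the Boolean interval above its restriction \<open>dom (rev gs ! r)\<close>; these intervals
  partition the poset.\<close>

lemma faces_idx: "r < length gs \<Longrightarrow> {p \<in> faces. idx p = r} = (\<lambda>S. face (dom (rev gs ! r) \<union> S) r) ` Pow ({..<d} - dom (rev gs ! r))"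
proof (intro equalityI subsetI)
  fix p assume r: "r < length gs" and p: "p \<in> {p \<in> faces. idx p = r}"
  then have "dom (rev gs ! r) \<subseteq> col p" "col p \<subseteq> {..<d}"
    using rep_eq_iff[OF glued r, of "col p"] facesD[of p] by auto
  then have *: "dom (rev gs ! r) \<union> (col p - dom (rev gs ! r)) = col p"
    and in_Pow: "col p - dom (rev gs ! r) \<in> Pow ({..<d} - dom (rev gs ! r))" by auto
  have "p = face (col p) r" using p face_col_idx[of p] by simp
  then have "p = face (dom (rev gs ! r) \<union> (col p - dom (rev gs ! r))) r" unfolding * .
  then show "p \<in> (\<lambda>S. face (dom (rev gs ! r) \<union> S) r) ` Pow ({..<d} - dom (rev gs ! r))"
    using in_Pow by (rule image_eqI)
next
  fix p assume r: "r < length gs"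
    and "p \<in> (\<lambda>S. face (dom (rev gs ! r) \<union> S) r) ` Pow ({..<d} - dom (rev gs ! r))"
  then obtain S where S: "S \<subseteq> {..<d}" "p = face (dom (rev gs ! r) \<union> S) r" by blast
  have sub: "dom (rev gs ! r) \<union> S \<subseteq> {..<d}" using glued_dom[OF glued r] S(1) by blast
  then have "finite (dom (rev gs ! r) \<union> S)" using finite_subset by blast
  then show "p \<in> {p \<in> faces. idx p = r}"
    using rep_eq_iff[OF glued r] r sub unfolding faces_def S(2) by simp
qed

text \<open>Over one interval of this partition the sum of \<open>x ^ i * (1 - x) ^ (d - i)\<close>
  is \<open>x\<close> to the size of the restriction times a power of
  \<open>x + (1 - x) = 1\<close>.\<close>

lemma h_polynomial:
  "(\<Sum>i\<le>d. smult (int (fnum faces face_le bottom i)) ([:0, 1:] ^ i * [:1, -1:] ^ (d - i))) =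
    (\<Sum>r<length gs. monom 1 (card (dom (rev gs ! r))))"
proof -
  define X Y where "X = [:0, 1 :: int:]" and "Y = [:1, -1 :: int:]"
  define w where "w = (\<lambda>p. X ^ card (col p) * Y ^ (d - card (col p)))"
  have "(\<Sum>i\<le>d. smult (int (fnum faces face_le bottom i)) (X ^ i * Y ^ (d - i))) =
      (\<Sum>i\<le>d. \<Sum>p\<in>{p \<in> faces. card (col p) = i}. w p)"
  proof (rule sum.cong[OF refl])
    fix i
    have "(\<Sum>p\<in>{p \<in> faces. card (col p) = i}. w p) =
        (\<Sum>p\<in>{p \<in> faces. card (col p) = i}. X ^ i * Y ^ (d - i))"
      by (intro sum.cong) (auto simp: w_def)
    then show "smult (int (fnum faces face_le bottom i)) (X ^ i * Y ^ (d - i)) =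
        (\<Sum>p\<in>{p \<in> faces. card (col p) = i}. w p)"
      by (simp add: fnum_eq of_nat_poly)
  qed
  also have "\<dots> = (\<Sum>p\<in>faces. w p)"
    by (rule sum.group) (use finite_faces card_col_le in auto)
  also have "\<dots> = (\<Sum>r<length gs. \<Sum>p\<in>{p \<in> faces. idx p = r}. w p)"
    by (rule sum.group[symmetric]) (use finite_faces facesD(2) in auto)
  also have "\<dots> = (\<Sum>r<length gs. monom 1 (card (dom (rev gs ! r))))"
  proof (rule sum.cong[OF refl])
    fix r assume "r \<in> {..<length gs}"
    then have r: "r < length gs" by simp
    define T where "T = dom (rev gs ! r)"
    have T: "T \<subseteq> {..<d}" using glued_dom[OF glued r] by (simp add: T_def)
    then have finT: "finite T" using finite_subset by blast
    let ?A = "{..<d} - T"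
    have colS: "col (face (T \<union> S) r) = T \<union> S" if "S \<in> Pow ?A" for S
      using that finT finite_subset[of S "{..<d}"] by (intro col_face) auto
    have card: "card (T \<union> S) = card T + card S" "d - (card T + card S) = card (?A - S)" if "S \<in> Pow ?A" for S
    proof -
      have fS: "finite S" using that finite_subset[of S "{..<d}"] by auto
      then show *: "card (T \<union> S) = card T + card S" using that finT by (intro card_Un_disjoint) auto
      have "?A - S = {..<d} - (T \<union> S)" by auto
      then have "card (?A - S) = d - card (T \<union> S)" using card_Diff_subset[of "T \<union> S" "{..<d}"] fS finT T that by auto
      then show "d - (card T + card S) = card (?A - S)" using * by simp
    qed
    have "inj_on (\<lambda>S. face (T \<union> S) r) (Pow ?A)"
    proof (rule inj_onI)
      fix S S' assume S: "S \<in> Pow ?A" "S' \<in> Pow ?A" "face (T \<union> S) r = face (T \<union> S') r"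
      then have "T \<union> S = T \<union> S'" using colS by metis
      then show "S = S'" using S(1,2) by blast
    qed
    then have "(\<Sum>p\<in>{p \<in> faces. idx p = r}. w p) = (\<Sum>S\<in>Pow ?A. w (face (T \<union> S) r))"
      using faces_idx[OF r] unfolding T_def by (simp add: sum.reindex)
    also have "\<dots> = (\<Sum>S\<in>Pow ?A. X ^ card T * ((\<Prod>i\<in>S. X) * (\<Prod>i\<in>?A - S. Y)))"
      by (intro sum.cong refl) (simp add: w_def colS card power_add mult.assoc)
    also have "\<dots> = X ^ card T * (\<Prod>i\<in>?A. X + Y)"
      using prod_add[of ?A "\<lambda>_. X" "\<lambda>_. Y"] by (simp only: sum_distrib_left finite_Diff finite_lessThan)
    also have "X + Y = 1" by (simp add: X_def Y_def one_pCons)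
    finally show "(\<Sum>p\<in>{p \<in> faces. idx p = r}. w p) = monom 1 (card (dom (rev gs ! r)))"
      by (simp add: X_def T_def monom_altdef)
  qed
  finally show ?thesis by (simp add: X_def Y_def)
qed

section \<open>The simplices inside the realization\<close>

abbreviation real_space :: "(nat \<Rightarrow> real) set" where
  "real_space \<equiv> realization faces face_le bottom"

text \<open>The vertex \<open>p\<close> of the subdivision is the barycentre of the face
  \<open>p\<close>, with weight \<open>1 / card (col p)\<close> on each colour. By recording colours
  only, \<open>coords\<close> folds the whole complex onto one simplex.\<close>

definition coords :: "(nat \<Rightarrow> real) \<Rightarrow> nat \<Rightarrow> real" where
  "coords t = (\<lambda>c. \<Sum>p\<in>faces - {bottom}. if c \<in> col p then t p / card (col p) else 0)"

definition closed_cell :: "nat \<Rightarrow> (nat \<Rightarrow> real) set" where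
  "closed_cell k = {t \<in> real_space. \<forall>p. t p \<noteq> 0 \<longrightarrow> face_le p (cell k {..<d})}"

lemma realizationD:
  assumes "t \<in> real_space"
  shows "0 \<le> t q" "t q \<noteq> 0 \<Longrightarrow> q \<in> faces - {bottom}" "(\<Sum>q\<in>faces - {bottom}. t q) = 1"
    "t q \<noteq> 0 \<Longrightarrow> t r \<noteq> 0 \<Longrightarrow> face_le q r \<or> face_le r q"
  using assms unfolding realization_def by blast+

lemma card_col_pos: "p \<in> faces - {bottom} \<Longrightarrow> 0 < card (col p)"
  using col_empty_iff[of p] by (auto simp: card_gt_0_iff)

lemma coords_nonneg: "t \<in> real_space \<Longrightarrow> 0 \<le> coords t c"
  unfolding coords_def by (rule sum_nonneg) (simp add: realizationD(1))

lemma coords_pos: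
  assumes t: "t \<in> real_space" and p: "t p \<noteq> 0" "c \<in> col p"
  shows "coords t c \<noteq> 0"
proof -
  have "0 < coords t c"
    unfolding coords_def
  proof (rule sum_pos2)
    show "p \<in> faces - {bottom}" by (rule realizationD(2)[OF t p(1)])
    then have "0 < card (col p)" by (rule card_col_pos)
    then show "0 < (if c \<in> col p then t p / card (col p) else 0)"
      using realizationD(1)[OF t, of p] p by simp
  qed (use finite_faces realizationD(1)[OF t] in auto)
  then show ?thesis by simp
qed

lemma coords_zero: "(\<And>p. t p \<noteq> 0 \<Longrightarrow> c \<notin> col p) \<Longrightarrow> coords t c = 0"
  unfolding coords_def by (intro sum.neutral) auto

lemma sum_over_col:
  assumes "p \<in> faces" shows "(\<Sum>c<d. if c \<in> col p then a else 0) = of_nat (card (col p)) * (a :: real)"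
proof -
  have "{..<d} \<inter> col p = col p" using facesD(1)[OF assms] by auto
  then show ?thesis by (simp add: sum.If_cases)
qed

lemma coords_in:
  assumes t: "t \<in> real_space"
  shows "coords t \<in> std_simplex d"
proof -
  have "(\<Sum>c<d. coords t c) =
      (\<Sum>p\<in>faces - {bottom}. \<Sum>c<d. if c \<in> col p then t p / card (col p) else 0)"
    unfolding coords_def by (rule sum.swap)
  also have "\<dots> = (\<Sum>p\<in>faces - {bottom}. t p)"
  proof (rule sum.cong[OF refl])
    fix p assume p: "p \<in> faces - {bottom}"
    then have "(\<Sum>c<d. if c \<in> col p then t p / card (col p) else 0) = card (col p) * (t p / card (col p))"
      by (intro sum_over_col) simp
    also have "\<dots> = t p"
    proof -
      have "real (card (col p)) \<noteq> 0" using card_col_pos[OF p] by auto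
      then show ?thesis by (simp only: nonzero_mult_div_cancel_left times_divide_eq_right not_False_eq_True)
    qed
    finally show "(\<Sum>c<d. if c \<in> col p then t p / card (col p) else 0) = t p" .
  qed
  also have "\<dots> = 1" by (rule realizationD(3)[OF t])
  finally have "(\<Sum>c<d. coords t c) = 1" .
  moreover have "coords t c = 0" if "d \<le> c" for c
    using realizationD(2)[OF t] facesD(1) that by (intro coords_zero) fastforce
  ultimately show ?thesis using coords_nonneg[OF t] by (simp add: std_simplex_def)
qed

lemma continuous_coords: "continuous_on A coords"
proof (rule continuous_on_coordinatewise_then_product)
  fix c
  show "continuous_on A (\<lambda>t. coords t c)"
    unfolding coords_def
  proof (rule continuous_on_sum)
    fix p
    assume p: "p \<in> faces - {bottom}"
    show "continuous_on A (\<lambda>t. if c \<in> col p then t p / card (col p) else 0)"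
    proof (cases "c \<in> col p")
      case True
      then show ?thesis using card_col_pos[OF p] by (auto intro!: continuous_intros)
    qed simp
  qed
qed

text \<open>The largest element of the chain carrying \<open>t\<close> is the smallest face
  containing the point, and its colours are the support of the coordinates.\<close>

lemma support_top:
  assumes t: "t \<in> real_space"
  shows "\<exists>q. t q \<noteq> 0 \<and> col q = supp (coords t) \<and> (\<forall>p. t p \<noteq> 0 \<longrightarrow> face_le p q)"
proof -
  let ?U = "{q. t q \<noteq> 0}"
  have fin: "finite (col ` ?U)"
    using realizationD(2)[OF t] finite_faces by (intro finite_imageI finite_subset[of ?U faces]) auto
  have "?U \<noteq> {}" using realizationD(3)[OF t] by fastforce
  moreover have "A \<subseteq> B \<or> B \<subseteq> A" if "A \<in> col ` ?U" "B \<in> col ` ?U" for A B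
    using that realizationD(4)[OF t] face_leD(1) by (metis (mono_tags, lifting) imageE mem_Collect_eq)
  ultimately obtain q where q: "t q \<noteq> 0" "\<And>p. t p \<noteq> 0 \<Longrightarrow> col p \<subseteq> col q"
    using finite_chain_max[OF fin] by auto
  have "face_le p q" if "t p \<noteq> 0" for p
    using realizationD(2,4)[OF t] that q facesD(3) face_le_antisym[of q p] by (metis DiffD1 face_le_def)
  moreover have "col q = supp (coords t)"
    using coords_pos[OF t q(1)] coords_zero[of t] q(2) by blast
  ultimately show ?thesis using q(1) by blast
qed

lemma col_cell [simp]: "S \<subseteq> {..<d} \<Longrightarrow> col (cell k S) = S"
  using finite_subset[of S "{..<d}"] by (simp add: cell_def)

lemma idx_top: "k < length gs \<Longrightarrow> idx (cell k {..<d}) = k"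
  by (simp add: cell_def rep_full)

lemma face_le_top: "k < length gs \<Longrightarrow> p \<in> faces \<Longrightarrow> face_le p (cell k {..<d}) \<longleftrightarrow> rep (col p) gs k = idx p"
  using facesD(1)[of p] by (simp add: face_le_def idx_top)

lemma cell_bij:
  assumes k: "k < length gs"
  shows "bij_betw (cell k) (Pow {..<d} - {{}}) {p \<in> faces - {bottom}. face_le p (cell k {..<d})}"
proof (rule bij_betw_byWitness[where f' = col])
  show "cell k ` (Pow {..<d} - {{}}) \<subseteq> {p \<in> faces - {bottom}. face_le p (cell k {..<d})}"
  proof
    fix p assume "p \<in> cell k ` (Pow {..<d} - {{}})"
    then obtain S where S: "S \<subseteq> {..<d}" "S \<noteq> {}" "p = cell k S" by blast
    then have "p \<in> faces" "col p \<noteq> {}" using cell_in[OF S(1) k] by simp_all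
    moreover have "face_le p (cell k {..<d})"
      using cell_le[OF cell_in[OF subset_refl k], of S] S idx_top[OF k] by simp
    ultimately show "p \<in> {p \<in> faces - {bottom}. face_le p (cell k {..<d})}" using col_empty_iff by auto
  qed
  show "\<forall>p\<in>{p \<in> faces - {bottom}. face_le p (cell k {..<d})}. cell k (col p) = p"
    using face_le_eq_cell[of _ "cell k {..<d}"] idx_top[OF k] by simp
  show "col ` {p \<in> faces - {bottom}. face_le p (cell k {..<d})} \<subseteq> Pow {..<d} - {{}}"
    using facesD(1) col_empty_iff by auto
qed auto

lemma sum_cell:
  assumes k: "k < length gs" and t: "\<And>p. t p \<noteq> 0 \<Longrightarrow> face_le p (cell k {..<d})" and f0: "\<And>p. t p = 0 \<Longrightarrow> f p = (0 :: real)"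
  shows "(\<Sum>p\<in>faces - {bottom}. f p) = (\<Sum>S\<in>Pow {..<d} - {{}}. f (cell k S))"
proof -
  have "(\<Sum>p\<in>faces - {bottom}. f p) = (\<Sum>p\<in>{p \<in> faces - {bottom}. face_le p (cell k {..<d})}. f p)"
    using finite_faces t f0 by (intro sum.mono_neutral_right) auto
  then show ?thesis using sum.reindex_bij_betw[OF cell_bij[OF k], of f] by simp
qed

lemma coords_cell:
  assumes k: "k < length gs" and t: "\<And>p. t p \<noteq> 0 \<Longrightarrow> face_le p (cell k {..<d})"
  shows "coords t c = (\<Sum>S\<in>Pow {..<d}. if c \<in> S then (if S = {} then 0 else t (cell k S) / card S) else 0)"
proof -
  have "coords t c = (\<Sum>S\<in>Pow {..<d} - {{}}. if c \<in> col (cell k S) then t (cell k S) / card (col (cell k S)) else 0)"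
    unfolding coords_def by (rule sum_cell[where t = t, OF k]) (simp_all add: t)
  also have "\<dots> = (\<Sum>S\<in>Pow {..<d} - {{}}. if c \<in> S then (if S = {} then 0 else t (cell k S) / card S) else 0)"
    by (intro sum.cong) auto
  also have "\<dots> = (\<Sum>S\<in>Pow {..<d}. if c \<in> S then (if S = {} then 0 else t (cell k S) / card S) else 0)"
    by (intro sum.mono_neutral_left) auto
  finally show ?thesis .
qed

text \<open>Dividing by \<open>card S\<close> turns the weight of a barycentre into the coefficient
  of an indicator function, as \<open>chain_decomp\<close> requires.\<close>

definition weights :: "nat \<Rightarrow> (nat \<Rightarrow> real) \<Rightarrow> nat set \<Rightarrow> real" where
  "weights k t S = (if S \<in> Pow {..<d} - {{}} then t (cell k S) / card S else 0)"

lemma closed_cellD: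
  assumes "t \<in> closed_cell k"
  shows "t \<in> real_space" "t p \<noteq> 0 \<Longrightarrow> face_le p (cell k {..<d})"
  using assms by (auto simp: closed_cell_def)

lemma chain_decomp_weights:
  assumes k: "k < length gs" and t: "t \<in> closed_cell k"
  shows "chain_decomp {..<d} (coords t) (weights k t)"
  unfolding chain_decomp_def
proof (intro conjI allI impI ballI)
  note t' = closed_cellD[OF t]
  show "0 \<le> weights k t S" for S using realizationD(1)[OF t'(1)] by (simp add: weights_def)
  show "S \<subseteq> {..<d}" "S \<noteq> {}" if "weights k t S \<noteq> 0" for S
    using that by (auto simp: weights_def split: if_splits)
  show "S \<subseteq> S' \<or> S' \<subseteq> S" if "weights k t S \<noteq> 0 \<and> weights k t S' \<noteq> 0" for S S'
  proof -
    have S: "S \<subseteq> {..<d}" "t (cell k S) \<noteq> 0" "S' \<subseteq> {..<d}" "t (cell k S') \<noteq> 0"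
      using that by (auto simp: weights_def split: if_splits)
    then show ?thesis using realizationD(4)[OF t'(1) S(2,4)] face_leD(1) by fastforce
  qed
  show "coords t c = (\<Sum>S\<in>Pow {..<d}. if c \<in> S then weights k t S else 0)" for c
  proof (subst coords_cell[where t = t, OF k])
    show "(\<Sum>S\<in>Pow {..<d}. if c \<in> S then (if S = {} then 0 else t (cell k S) / card S) else 0) =
        (\<Sum>S\<in>Pow {..<d}. if c \<in> S then weights k t S else 0)"
      by (intro sum.cong) (auto simp: weights_def)
  qed (rule t'(2))
qed

text \<open>Within one simplex faces correspond to colour sets, so this is the uniqueness of chain
  decompositions, just as surjectivity is their existence.\<close>

lemma coords_inj:
  assumes k: "k < length gs"
  shows "inj_on coords (closed_cell k)"
proof (rule inj_onI)
  fix t t' assume t: "t \<in> closed_cell k" "t' \<in> closed_cell k" "coords t = coords t'"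
  have w: "weights k t = weights k t'"
    using chain_decomp_unique[of "{..<d}" "coords t"] chain_decomp_weights[OF k t(1)] chain_decomp_weights[OF k t(2)] t(3)
    by simp
  show "t = t'"
  proof
    fix p
    show "t p = t' p"
    proof (cases "p \<in> {p \<in> faces - {bottom}. face_le p (cell k {..<d})}")
      case True
      then obtain S where S: "S \<in> Pow {..<d} - {{}}" "p = cell k S"
        using cell_bij[OF k] unfolding bij_betw_def by blast
      then have "card S \<noteq> 0" using finite_subset[of S "{..<d}"] by auto
      then show ?thesis using fun_cong[OF w, of S] S by (simp add: weights_def)
    next
      case False
      then have "t p = 0" "t' p = 0"
        using closed_cellD[OF t(1)] closed_cellD[OF t(2)] realizationD(2) by blast+
      then show ?thesis by simp
    qed
  qed
qed

lemma coords_surj: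
  assumes k: "k < length gs" and x: "x \<in> std_simplex d"
  shows "\<exists>t\<in>closed_cell k. coords t = x"
proof -
  obtain u where u: "chain_decomp {..<d} x u"
    using chain_decomp_exists[of "{..<d}" x] std_simplexD(1)[OF x] by auto
  define t where "t = (\<lambda>p. if p \<in> faces - {bottom} \<and> face_le p (cell k {..<d}) then card (col p) * u (col p) else 0)"
  have tD: "p \<in> faces - {bottom}" "face_le p (cell k {..<d})" "u (col p) \<noteq> 0" if "t p \<noteq> 0" for p
    using that by (auto simp: t_def split: if_splits)
  have t_cell: "t (cell k S) = card S * u S" if "S \<in> Pow {..<d} - {{}}" for S
  proof -
    have "cell k S \<in> {p \<in> faces - {bottom}. face_le p (cell k {..<d})}"
      using bij_betwE[OF cell_bij[OF k]] that by blast
    moreover have "col (cell k S) = S" using that by simp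
    ultimately show ?thesis unfolding t_def by simp
  qed
  have card0: "card S \<noteq> 0" if "S \<in> Pow {..<d} - {{}}" for S
    using that finite_subset[of S "{..<d}"] by auto
  have coords: "coords t c = x c" for c
  proof (cases "c < d")
    case True
    have "coords t c = (\<Sum>S\<in>Pow {..<d}. if c \<in> S then u S else 0)"
    proof (subst coords_cell[where t = t, OF k])
      show "(\<Sum>S\<in>Pow {..<d}. if c \<in> S then (if S = {} then 0 else t (cell k S) / card S) else 0) =
          (\<Sum>S\<in>Pow {..<d}. if c \<in> S then u S else 0)"
        using t_cell card0 by (intro sum.cong) auto
    qed (rule tD(2))
    then show ?thesis using chain_decompD(5)[OF u, of c] True by simp
  next
    case False
    then have "coords t c = 0" using tD(1) facesD(1) by (intro coords_zero) fastforce
    then show ?thesis using std_simplexD(2)[OF x] False by simp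
  qed
  have "(\<Sum>p\<in>faces - {bottom}. t p) = (\<Sum>S\<in>Pow {..<d} - {{}}. t (cell k S))"
    by (rule sum_cell[where t = t, OF k]) (simp_all add: tD(2))
  also have "\<dots> = (\<Sum>S\<in>Pow {..<d} - {{}}. card S * u S)"
    by (intro sum.cong refl t_cell)
  also have "\<dots> = (\<Sum>S\<in>Pow {..<d}. card S * u S)"
    by (intro sum.mono_neutral_left) auto
  \<comment> \<open>Double counting: a set contributes its coefficient once for each of its colours,
    so the total is the sum of the coordinates of \<open>x\<close>.\<close>
  also have "\<dots> = (\<Sum>S\<in>Pow {..<d}. \<Sum>c<d. if c \<in> S then u S else 0)"
  proof (rule sum.cong[OF refl])
    fix S assume "S \<in> Pow {..<d}"
    then have "{..<d} \<inter> S = S" by auto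
    then show "card S * u S = (\<Sum>c<d. if c \<in> S then u S else 0)" by (simp add: sum.If_cases)
  qed
  also have "\<dots> = (\<Sum>c<d. \<Sum>S\<in>Pow {..<d}. if c \<in> S then u S else 0)" by (rule sum.swap)
  also have "\<dots> = (\<Sum>c<d. x c)" using chain_decompD(5)[OF u] by (intro sum.cong) auto
  also have "\<dots> = 1" by (rule std_simplexD(3)[OF x])
  finally have sum1: "(\<Sum>p\<in>faces - {bottom}. t p) = 1" .
  have "0 \<le> t p" for p using chain_decompD(1)[OF u] by (simp add: t_def)
  moreover have "face_le p q \<or> face_le q p" if "t p \<noteq> 0" "t q \<noteq> 0" for p q
    using tD[OF that(1)] tD[OF that(2)] chain_decompD(4)[OF u, of "col p" "col q"]
      face_le_below[of p _ q] face_le_below[of q _ p] by blast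
  ultimately have "t \<in> real_space" unfolding realization_def using tD(1) sum1 by blast
  then have "t \<in> closed_cell k" using tD(2) by (simp add: closed_cell_def)
  then show ?thesis using coords by blast
qed

lemma compact_closed_cell: "compact (closed_cell k)"
proof -
  let ?R = "faces - {bottom}"
  \<comment> \<open>Comparability within the carrier is rewritten as vanishing of products, which is
    visibly a closed condition.\<close>
  have eq: "closed_cell k = {t. \<forall>q. 0 \<le> t q \<and> t q \<le> 1} \<inter>
      {t. (\<forall>q. q \<notin> ?R \<or> \<not> face_le q (cell k {..<d}) \<longrightarrow> t q = 0) \<and> (\<Sum>q\<in>?R. t q) = 1 \<and>
          (\<forall>q r. \<not> face_le q r \<and> \<not> face_le r q \<longrightarrow> t q * t r = 0)}" (is "_ = ?C \<inter> ?D")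
  proof (intro equalityI subsetI IntI)
    fix t assume t: "t \<in> closed_cell k"
    note R = realizationD[OF closed_cellD(1)[OF t]]
    have "t q \<le> 1" for q
    proof (cases "q \<in> ?R")
      case True
      then have "t q \<le> (\<Sum>q\<in>?R. t q)" using R(1) finite_faces by (intro member_le_sum) auto
      then show ?thesis using R(3) by simp
    next
      case False
      then have "t q = 0" using R(2)[of q] by blast
      then show ?thesis by simp
    qed
    then show "t \<in> ?C" using R(1) by blast
    show "t \<in> ?D" using R(2,3,4) closed_cellD(2)[OF t] by fastforce
  next
    fix t assume t: "t \<in> ?C \<inter> ?D"
    then have prod0: "\<And>q r. \<not> face_le q r \<Longrightarrow> \<not> face_le r q \<Longrightarrow> t q * t r = 0" by blast
    have "face_le q r \<or> face_le r q" if "t q \<noteq> 0 \<and> t r \<noteq> 0" for q r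
      using prod0[of q r] that by auto
    then show "t \<in> closed_cell k" using t unfolding closed_cell_def realization_def by blast
  qed
  have "closed ?D"
    by (intro closed_Collect_conj closed_Collect_all closed_Collect_imp closed_Collect_eq open_Collect_const
        continuous_intros)
  then show ?thesis unfolding eq by (intro compact_Int_closed compact_unit_cube)
qed

lemma real_space_eq: "real_space = (\<Union>k<length gs. closed_cell k)"
proof (intro equalityI subsetI)
  fix t assume t: "t \<in> real_space"
  obtain q where q: "t q \<noteq> 0" "\<And>p. t p \<noteq> 0 \<Longrightarrow> face_le p q" using support_top[OF t] by blast
  have q': "q \<in> faces" using realizationD(2)[OF t q(1)] by simp
  have "face_le q (cell (idx q) {..<d})" using face_le_top[OF facesD(2) q'] facesD(3) q' by simp
  then have "t \<in> closed_cell (idx q)" using t q(2) face_le_trans by (auto simp: closed_cell_def)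
  then show "t \<in> (\<Union>k<length gs. closed_cell k)" using facesD(2)[OF q'] by blast
qed (auto simp: closed_cell_def)

definition point :: "nat \<Rightarrow> (nat \<Rightarrow> real) \<Rightarrow> nat \<Rightarrow> real" where
  "point k = the_inv_into (closed_cell k) coords"

lemma coords_image: "k < length gs \<Longrightarrow> coords ` closed_cell k = std_simplex d"
  using coords_surj[of k] coords_in closed_cellD(1) by blast

lemma point:
  assumes "k < length gs" "x \<in> std_simplex d"
  shows "point k x \<in> closed_cell k" "coords (point k x) = x"
  using assms coords_inj[of k] coords_image[of k]
  by (auto simp: point_def the_inv_into_into f_the_inv_into_f)

lemma point_coords: "k < length gs \<Longrightarrow> t \<in> closed_cell k \<Longrightarrow> point k (coords t) = t"
  unfolding point_def by (rule the_inv_into_f_f[OF coords_inj])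

lemma point_image: "k < length gs \<Longrightarrow> point k ` std_simplex d = closed_cell k"
proof -
  assume k: "k < length gs"
  have "point k ` coords ` closed_cell k = (\<lambda>t. t) ` closed_cell k"
    unfolding image_image by (intro image_cong refl point_coords[OF k])
  then show ?thesis by (simp add: coords_image[OF k])
qed

lemma continuous_point: "k < length gs \<Longrightarrow> continuous_on (std_simplex d) (point k)"
  using continuous_on_inv[OF continuous_coords compact_closed_cell, of k "point k"] point_coords coords_image by simp

text \<open>The smallest face of a point is coloured by the support of its coordinates; two
  simplices share the point exactly when they share this face. This is the rule that
  \<open>ball_pair_glued\<close> asks for.\<close>

lemma point_eq_iff:
  assumes j: "j < length gs" and k: "k < length gs" and x: "x \<in> std_simplex d" and y: "y \<in> std_simplex d"
  shows "point j x = point k y \<longleftrightarrow> x = y \<and> rep (supp x) gs j = rep (supp x) gs k"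
proof
  assume eq: "point j x = point k y"
  then have xy: "x = y" using point(2)[OF j x] point(2)[OF k y] by simp
  let ?t = "point j x"
  have t: "?t \<in> closed_cell j" "?t \<in> closed_cell k" using point(1)[OF j x] point(1)[OF k y] eq by auto
  obtain q where q: "?t q \<noteq> 0" "col q = supp (coords ?t)"
    using support_top[OF closed_cellD(1)[OF t(1)]] by blast
  then have "q \<in> faces" using realizationD(2)[OF closed_cellD(1)[OF t(1)]] by blast
  then have "rep (col q) gs j = idx q" "rep (col q) gs k = idx q"
    using closed_cellD(2)[OF t(1) q(1)] closed_cellD(2)[OF t(2) q(1)] face_le_top j k by auto
  then show "x = y \<and> rep (supp x) gs j = rep (supp x) gs k" using xy q(2) point(2)[OF j x] by simp
next
  assume eq: "x = y \<and> rep (supp x) gs j = rep (supp x) gs k"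
  let ?t = "point j x"
  have t: "?t \<in> closed_cell j" "coords ?t = x" by (rule point[OF j x])+
  have "?t \<in> closed_cell k"
    unfolding closed_cell_def
  proof (intro CollectI conjI allI impI)
    show tR: "?t \<in> real_space" by (rule closed_cellD(1)[OF t(1)])
    fix p assume p: "?t p \<noteq> 0"
    then have p': "p \<in> faces" using realizationD(2)[OF tR] by blast
    have sub: "col p \<subseteq> supp x" using coords_pos[OF tR p] t(2) by auto
    have "rep (col p) gs k = rep (col p) gs (rep (supp x) gs k)" using rep_rep'[OF sub] by simp
    also have "\<dots> = rep (col p) gs j" using rep_rep'[OF sub, of j] conjunct2[OF eq] by simp
    also have "\<dots> = idx p" using closed_cellD(2)[OF t(1) p] face_le_top[OF j p'] by simp
    finally show "face_le p (cell k {..<d})" using face_le_top[OF k p'] by simp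
  qed
  then show "point j x = point k y" using point_coords[OF k] t(2) eq by fastforce
qed

lemma realization_is_ball: "is_ball_of_dim real_space (d - 1)"
proof -
  have "real_space = (\<Union>k<length gs. point k ` std_simplex d)"
    unfolding real_space_eq using point_image by simp
  then have eq: "(\<Union>k<length gs. point k ` std_simplex d) = real_space" by (rule sym)
  have "ball_pair (d - 1) (\<Union>k<length gs. point k ` std_simplex d)
      (\<Union>(j, c)\<in>free_facets d gs. point j ` {x \<in> std_simplex d. x c = 0})"
    using glued d continuous_point point_eq_iff by (rule ball_pair_glued)
  then show ?thesis unfolding eq by (rule ball_pair_is_ball)
qed

end

section \<open>Ordering the types\<close>

abbreviation types :: "(nat \<rightharpoonup> nat) list \<Rightarrow> nat list" where
  "types gs \<equiv> map (\<lambda>g. card (dom g)) gs"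

text \<open>The newest simplex has \<open>d - hd (types gs)\<close> free facets, and any
  \<open>a\<close> of them form a patch by \<open>gluable_last\<close>.\<close>

lemma glued_chain_step:
  assumes gl: "glued d gs" and a: "1 \<le> a" "a < d" "a + hd (types gs) \<le> d"
  shows "\<exists>g. glued d (g # gs) \<and> card (dom g) = a"
proof -
  have ne: "gs \<noteq> []" using glued_length[OF gl] by auto
  then obtain g0 gs0 where gs: "gs = g0 # gs0" by (cases gs) auto
  have "dom g0 \<subseteq> {..<d}" using glued_dom[OF gl, of "length gs0"] gs by (simp add: nth_append)
  then have "card ({..<d} - dom g0) = d - card (dom g0)"
    using finite_subset[of "dom g0" "{..<d}"] by (simp add: card_Diff_subset)
  then have "a \<le> card ({..<d} - dom (hd gs))" using a(3) gs by simp
  then obtain T where T: "T \<subseteq> {..<d} - dom (hd gs)" "card T = a"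
    using obtain_subset_with_card_n by metis
  define g where "g = (\<lambda>c. if c \<in> T then Some (length gs - 1) else None)"
  have dom: "dom g = T" by (auto simp: g_def dom_def)
  have "gluable d gs (dom g) (\<lambda>c. the (g c))"
    using T(1) by (intro gluable_subset[OF gluable_last[OF gl]]) (auto simp: dom, simp add: g_def)
  moreover have "dom g \<noteq> {}" using T(2) a(1) dom by auto
  moreover have "dom g \<subset> {..<d}" using T a(2) dom by (auto simp: psubset_eq)
  ultimately have "glued d (g # gs)" by (intro glued.attach[OF gl])
  then show ?thesis using dom T(2) by blast
qed

lemma ends_cases:
  assumes "\<And>x. L = [x] \<Longrightarrow> thesis" "L = [] \<Longrightarrow> thesis" "\<And>a M t. L = a # M @ [t] \<Longrightarrow> thesis"
  shows thesis
proof (cases L)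
  case (Cons a L')
  then show ?thesis using assms by (cases L' rule: rev_cases) auto
qed (use assms in simp)

text \<open>The list is attached from the middle outwards, alternating between its two halves.\<close>
lemma glued_chain:
  assumes "sorted L" "\<And>x. x \<in> set L \<Longrightarrow> 1 \<le> x \<and> x < d"
    and "\<And>k. k < length L \<Longrightarrow> L ! k + L ! (length L - 1 - k) \<le> d"
    and "glued d gs" "L \<noteq> [] \<Longrightarrow> L ! ((length L - 1) div 2) + hd (types gs) \<le> d"
  shows "\<exists>gs'. glued d gs' \<and> mset (types gs') = mset (types gs) + mset L \<and>
      hd (types gs') = (if L = [] then hd (types gs) else last L)"
  using assms
proof (induction "length L" arbitrary: L rule: less_induct)
  case less
  show ?case
  proof (cases L rule: ends_cases)
    case (1 x)
    then obtain g where "glued d (g # gs)" "card (dom g) = x"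
      using glued_chain_step[OF less.prems(4), of x] less.prems(2)[of x] less.prems(5) by auto
    then show ?thesis using 1 by (intro exI[of _ "g # gs"]) simp
  next
    case 2
    then show ?thesis using less.prems(4) by auto
  next
    case (3 a M t)
    have nth: "L ! Suc k = M ! k" if "k < length M" for k using 3 that by (simp add: nth_append)
    have sym: "M ! k + M ! (length M - 1 - k) \<le> d" if k: "k < length M" for k
    proof -
      have "length L - 1 - Suc k = Suc (length M - 1 - k)" using 3 k by simp
      then show ?thesis using less.prems(3)[of "Suc k"] nth[of k] nth[of "length M - 1 - k"] 3 k by simp
    qed
    have mid: "M ! ((length M - 1) div 2) + hd (types gs) \<le> d" if "M \<noteq> []"
    proof -
      have "(length L - 1) div 2 = Suc ((length M - 1) div 2)" "(length M - 1) div 2 < length M"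
        using 3 that by (cases M; simp)+
      then show ?thesis using less.prems(5) nth[of "(length M - 1) div 2"] 3 by simp
    qed
    have "sorted M" "\<And>x. x \<in> set M \<Longrightarrow> x \<le> t"
      using less.prems(1) 3 by (auto simp: sorted_append)
    then obtain gs1 where gs1: "glued d gs1" "mset (types gs1) = mset (types gs) + mset M"
        "hd (types gs1) = (if M = [] then hd (types gs) else last M)"
      using less.hyps[of M] sym mid less.prems(2,4) 3 by auto
    have at: "a + t \<le> d" using less.prems(3)[of 0] 3 by (simp add: nth_append)
    \<comment> \<open>The inner list is finished by its largest entry, which is at most
      \<open>t\<close>; so \<open>a + t \<le> d\<close> lets \<open>a\<close> follow it, and then
      \<open>t\<close> follow \<open>a\<close>.\<close>
    have "a + hd (types gs1) \<le> d"
    proof (cases "M = []")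
      case True
      then show ?thesis using less.prems(5) gs1(3) 3 by simp
    next
      case False
      then show ?thesis using at gs1(3) \<open>\<And>x. x \<in> set M \<Longrightarrow> x \<le> t\<close>[of "last M"] by simp
    qed
    then obtain g where g: "glued d (g # gs1)" "card (dom g) = a"
      using glued_chain_step[OF gs1(1), of a] less.prems(2)[of a] 3 by auto
    then obtain g' where "glued d (g' # g # gs1)" "card (dom g') = t"
      using glued_chain_step[OF g(1), of t] less.prems(2)[of t] at 3 by auto
    then show ?thesis using g gs1(2) 3 by (intro exI[of _ "g' # g # gs1"]) simp
  qed
qed

text \<open>Opposite entries are attached as pairs, from the middle outwards, and by
  \<open>gluable_pair\<close> each pair restores a patch with colours \<open>{..<m}\<close>. Even
  length excludes an unpaired middle entry.\<close>

lemma glued_pairs: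
  assumes "even (length L)" "\<And>x. x \<in> set L \<Longrightarrow> 1 \<le> x \<and> x \<le> m"
    and "\<And>k. k < length L \<Longrightarrow> m \<le> L ! k + L ! (length L - 1 - k) \<and> L ! k + L ! (length L - 1 - k) \<le> d"
    and "glued d gs" "gluable d gs {..<m} \<rho>"
  shows "\<exists>gs' \<rho>'. glued d gs' \<and> mset (types gs') = mset (types gs) + mset L \<and> gluable d gs' {..<m} \<rho>'"
  using assms
proof (induction "length L" arbitrary: L rule: less_induct)
  case less
  show ?case
  proof (cases L rule: ends_cases)
    case (1 x)
    then show ?thesis using less.prems(1) by simp
  next
    case 2
    then show ?thesis using less.prems(4,5) by auto
  next
    case (3 a M t)
    have nth: "L ! Suc k = M ! k" if "k < length M" for k using 3 that by (simp add: nth_append)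
    have sym: "m \<le> M ! k + M ! (length M - 1 - k) \<and> M ! k + M ! (length M - 1 - k) \<le> d" if k: "k < length M" for k
    proof -
      have "length L - 1 - Suc k = Suc (length M - 1 - k)" using 3 k by simp
      then show ?thesis using less.prems(3)[of "Suc k"] nth[of k] nth[of "length M - 1 - k"] 3 k by simp
    qed
    then obtain gs1 \<rho>1 where gs1: "glued d gs1" "mset (types gs1) = mset (types gs) + mset M"
        "gluable d gs1 {..<m} \<rho>1"
      using less.hyps[of M] less.prems(1,2,4,5) 3 by auto
    have at: "0 < a" "a \<le> m" "0 < t" "a + t \<le> d" "m \<le> a + t"
      using less.prems(2)[of a] less.prems(2)[of t] less.prems(3)[of 0] 3 by (auto simp: nth_append)
    let ?g = "\<lambda>c. if c < a then Some (\<rho>1 c) else None"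
    let ?h = "\<lambda>c. if a \<le> c \<and> c < a + t then Some (length gs1) else None"
    have "dom ?g = {..<a}" "dom ?h = {a..<a+t}" by (auto simp: dom_def)
    then have "mset (types (?h # ?g # gs1)) = mset (types gs) + mset L" using gs1(2) 3 by simp
    then show ?thesis using gluable_pair[OF gs1(1,3) at] by blast
  qed
qed

section \<open>Types with multiplicities as a sorted list\<close>

definition expand :: "(nat \<Rightarrow> nat) \<Rightarrow> nat \<Rightarrow> nat list" where
  "expand u d = concat (map (\<lambda>i. replicate (u i) i) [1..<d])"

lemma expand_Suc: "1 \<le> d \<Longrightarrow> expand u (Suc d) = expand u d @ replicate (u d) d"
  by (simp add: expand_def)

lemma set_expand: "x \<in> set (expand u d) \<Longrightarrow> 1 \<le> x \<and> x < d \<and> u x \<noteq> 0"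
  by (auto simp: expand_def)

lemma sorted_expand: "sorted (expand u d)"
proof (induction d)
  case (Suc d)
  then show ?case
    using set_expand[of _ u d] by (cases "1 \<le> d") (force simp: expand_Suc sorted_append, simp add: expand_def)
qed (simp add: expand_def)

lemma length_filter_expand: "length (filter P (expand u d)) = (\<Sum>i\<in>{1..<d}. if P i then u i else 0)"
proof (induction d)
  case (Suc d)
  then show ?case by (cases "1 \<le> d") (simp_all add: expand_Suc, simp add: expand_def)
qed (simp add: expand_def)

lemma length_expand: "length (expand u d) = (\<Sum>i\<in>{1..<d}. u i)"
  using length_filter_expand[of "\<lambda>_. True" u d] by simp

lemma length_filter_expand_le: "l < d \<Longrightarrow> length (filter (\<lambda>x. x \<le> l) (expand u d)) = (\<Sum>i\<in>{1..l}. u i)"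
  unfolding length_filter_expand by (intro sum.mono_neutral_cong_right) auto

lemma length_filter_expand_ge: "1 \<le> v \<Longrightarrow> length (filter (\<lambda>x. v \<le> x) (expand u d)) = (\<Sum>i\<in>{v..<d}. u i)"
  unfolding length_filter_expand by (intro sum.mono_neutral_cong_right) auto

lemma sum_list_expand:
  fixes f :: "nat \<Rightarrow> 'a::comm_semiring_1"
  shows "sum_list (map f (expand u d)) = (\<Sum>i\<in>{1..<d}. of_nat (u i) * f i)"
proof (induction d)
  case (Suc d)
  then show ?case by (cases "1 \<le> d") (simp_all add: expand_Suc sum_list_replicate, simp add: expand_def)
qed (simp add: expand_def)

text \<open>Converts positions into counts, so that inequalities between partial sums of
  \<open>h\<close> can bound single entries.\<close>

lemma sorted_nth_le_iff:
  fixes L :: "nat list"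
  assumes "sorted L" "k < length L"
  shows "L ! k \<le> l \<longleftrightarrow> k < length (filter (\<lambda>x. x \<le> l) L)"
proof
  assume "L ! k \<le> l"
  have "{..k} \<subseteq> {i. i < length L \<and> L ! i \<le> l}"
  proof
    fix i assume "i \<in> {..k}"
    then have "L ! i \<le> L ! k" using assms by (intro sorted_nth_mono) auto
    then show "i \<in> {i. i < length L \<and> L ! i \<le> l}" using \<open>i \<in> {..k}\<close> \<open>L ! k \<le> l\<close> assms(2) by simp
  qed
  then have "card {..k} \<le> card {i. i < length L \<and> L ! i \<le> l}" by (intro card_mono) auto
  then show "k < length (filter (\<lambda>x. x \<le> l) L)" by (simp add: length_filter_conv_card)
next
  assume k: "k < length (filter (\<lambda>x. x \<le> l) L)"
  show "L ! k \<le> l"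
  proof (rule ccontr)
    assume "\<not> L ! k \<le> l"
    have "{i. i < length L \<and> L ! i \<le> l} \<subseteq> {..<k}"
    proof
      fix i assume i: "i \<in> {i. i < length L \<and> L ! i \<le> l}"
      show "i \<in> {..<k}"
      proof (rule ccontr)
        assume "i \<notin> {..<k}"
        then have "L ! k \<le> L ! i" using assms(1) i by (intro sorted_nth_mono) auto
        then show False using i \<open>\<not> L ! k \<le> l\<close> by simp
      qed
    qed
    then have "card {i. i < length L \<and> L ! i \<le> l} \<le> card {..<k}" by (intro card_mono) auto
    then show False using k by (simp add: length_filter_conv_card)
  qed
qed

lemma sorted_nth_ge_iff:
  fixes L :: "nat list"
  assumes "sorted L" "k < length L"
  shows "v \<le> L ! (length L - 1 - k) \<longleftrightarrow> k < length (filter (\<lambda>x. v \<le> x) L)"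
proof
  assume v: "v \<le> L ! (length L - 1 - k)"
  have "{length L - 1 - k..<length L} \<subseteq> {i. i < length L \<and> v \<le> L ! i}"
  proof
    fix i assume i: "i \<in> {length L - 1 - k..<length L}"
    then have "L ! (length L - 1 - k) \<le> L ! i" using assms(1) by (intro sorted_nth_mono) auto
    then show "i \<in> {i. i < length L \<and> v \<le> L ! i}" using i v by simp
  qed
  then have "card {length L - 1 - k..<length L} \<le> card {i. i < length L \<and> v \<le> L ! i}"
    by (intro card_mono) auto
  then show "k < length (filter (\<lambda>x. v \<le> x) L)" using assms(2) by (simp add: length_filter_conv_card)
next
  assume k: "k < length (filter (\<lambda>x. v \<le> x) L)"
  show "v \<le> L ! (length L - 1 - k)"
  proof (rule ccontr)
    assume v: "\<not> v \<le> L ! (length L - 1 - k)"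
    have "{i. i < length L \<and> v \<le> L ! i} \<subseteq> {length L - k..<length L}"
    proof
      fix i assume i: "i \<in> {i. i < length L \<and> v \<le> L ! i}"
      have "length L - 1 - k < length L" using assms(2) by simp
      then have "\<not> i \<le> length L - 1 - k"
        using sorted_nth_mono[OF assms(1), of i "length L - 1 - k"] v i by auto
      then show "i \<in> {length L - k..<length L}" using i by auto
    qed
    then have "card {i. i < length L \<and> v \<le> L ! i} \<le> card {length L - k..<length L}"
      by (intro card_mono) auto
    then show False using k assms(2) by (simp add: length_filter_conv_card)
  qed
qed

lemma symmetric_wlog:
  fixes L :: "nat list"
  assumes "\<And>k. k < length L \<Longrightarrow> k \<le> length L - 1 - k \<Longrightarrow> P (L ! k + L ! (length L - 1 - k))" "k < length L"
  shows "P (L ! k + L ! (length L - 1 - k))"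
proof (cases "k \<le> length L - 1 - k")
  case False
  then show ?thesis
    using assms(1)[of "length L - 1 - k"] assms(2) by (simp add: add.commute)
qed (use assms in blast)

text \<open>Let \<open>t\<close> be the larger of two opposite entries. More than \<open>k\<close>
  entries are at least \<open>t\<close>, hence more than \<open>k\<close> are at most
  \<open>d - t\<close>, among them the one in position \<open>k\<close>. For
  \<open>2 * t > d\<close> the number \<open>d - t\<close> is in the range of the hypothesis;
  otherwise the bound is immediate.\<close>

lemma expand_symmetric_le:
  assumes "\<And>l. 1 \<le> l \<Longrightarrow> l \<le> (d - 1) div 2 \<Longrightarrow> (\<Sum>i\<in>{d - l..<d}. u i) \<le> (\<Sum>i\<in>{1..l}. u i)"
    and "k < length (expand u d)"
  shows "expand u d ! k + expand u d ! (length (expand u d) - 1 - k) \<le> d"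
proof (rule symmetric_wlog[of "expand u d" "\<lambda>s. s \<le> d"])
  let ?L = "expand u d"
  fix k assume k: "k < length ?L" "k \<le> length ?L - 1 - k"
  define t where "t = ?L ! (length ?L - 1 - k)"
  have kt: "?L ! k \<le> t" unfolding t_def using k by (intro sorted_nth_mono sorted_expand) auto
  have "t \<in> set ?L" unfolding t_def using k by (intro nth_mem) auto
  then have t: "1 \<le> t" "t < d" using set_expand by auto
  show "?L ! k + ?L ! (length ?L - 1 - k) \<le> d"
  proof (cases "2 * t \<le> d")
    case True
    then show ?thesis using kt unfolding t_def by simp
  next
    case False
    have "k < length (filter (\<lambda>x. t \<le> x) ?L)"
      using sorted_nth_ge_iff[OF sorted_expand k(1), of t] by (simp add: t_def)
    also have "\<dots> = (\<Sum>i\<in>{d - (d - t)..<d}. u i)" using t by (simp add: length_filter_expand_ge)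
    also have "\<dots> \<le> (\<Sum>i\<in>{1..d - t}. u i)" using False t by (intro assms(1)) auto
    also have "\<dots> = length (filter (\<lambda>x. x \<le> d - t) ?L)" using t by (simp add: length_filter_expand_le)
    finally have "?L ! k \<le> d - t" using sorted_nth_le_iff[OF sorted_expand k(1)] by blast
    then show ?thesis using t unfolding t_def by simp
  qed
qed (rule assms(2))

text \<open>The mirror image of the preceding argument, starting from the smaller entry
  \<open>j\<close>. If \<open>j \<ge> d - 2 * n\<close>, the bound follows at once because the
  partner exceeds \<open>n\<close>.\<close>

lemma expand_symmetric_ge:
  assumes "\<And>i. u i \<noteq> 0 \<Longrightarrow> n < i \<and> i < d - n"
    and "\<And>j. n < j \<Longrightarrow> j < d - 2 * n \<Longrightarrow> (\<Sum>i\<in>{1..j}. u i) \<le> (\<Sum>i\<in>{d - n - j..<d}. u i)"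
    and "k < length (expand u d)"
  shows "d - n \<le> expand u d ! k + expand u d ! (length (expand u d) - 1 - k)"
proof (rule symmetric_wlog[of "expand u d" "\<lambda>s. d - n \<le> s"])
  let ?L = "expand u d"
  fix k assume k: "k < length ?L" "k \<le> length ?L - 1 - k"
  define j where "j = ?L ! k"
  have "j \<in> set ?L" unfolding j_def using k by (intro nth_mem) auto
  then have j: "n < j" "j < d - n" using set_expand assms(1) by blast+
  show "d - n \<le> ?L ! k + ?L ! (length ?L - 1 - k)"
  proof (cases "j < d - 2 * n")
    case True
    have "k < length (filter (\<lambda>x. x \<le> j) ?L)"
      using sorted_nth_le_iff[OF sorted_expand k(1), of j] by (simp add: j_def)
    also have "\<dots> = (\<Sum>i\<in>{1..j}. u i)" using j by (simp add: length_filter_expand_le)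
    also have "\<dots> \<le> (\<Sum>i\<in>{d - n - j..<d}. u i)" using True j by (intro assms(2)) auto
    also have "\<dots> = length (filter (\<lambda>x. d - n - j \<le> x) ?L)" using j by (simp add: length_filter_expand_ge)
    finally have "d - n - j \<le> ?L ! (length ?L - 1 - k)" using sorted_nth_ge_iff[OF sorted_expand k(1)] by blast
    then show ?thesis by (simp add: j_def)
  next
    case False
    have "?L ! (length ?L - 1 - k) \<in> set ?L" using k by (intro nth_mem) auto
    then have "n < ?L ! (length ?L - 1 - k)" using set_expand assms(1) by blast
    then show ?thesis using False unfolding j_def by simp
  qed
qed (rule assms(3))

lemma sum_mset_expand:
  fixes f :: "nat \<Rightarrow> 'a::comm_semiring_1"
  shows "(\<Sum>x\<in>#mset (expand u d). f x) = (\<Sum>i\<in>{1..<d}. of_nat (u i) * f i)"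
  using sum_list_expand[of f u d] by (simp flip: sum_mset_sum_list)

section \<open>From glued lists to posets, and the two cases\<close>

lemma poset_ball_from_glued:
  assumes "glued d gs" "0 < d" and "(\<Sum>t\<in>#mset (types gs). monom 1 t) = (\<Sum>i\<le>d. monom (int (h i)) i)"
  shows "\<exists>(P::nat set) le z. simplicial_poset P le z \<and> has_dim P le z d \<and>
           is_ball_of_dim (realization P le z) (d - 1) \<and> h_vector_is P le z d h"
proof -
  interpret glued_complex d gs using assms(1,2) by unfold_locales
  let ?m = "\<lambda>g :: nat \<rightharpoonup> nat. monom (1 :: int) (card (dom g))"
  have "sum_list (map (monom 1) (types gs)) = sum_list (rev (map ?m gs))" by (simp add: comp_def)
  also have "\<dots> = (\<Sum>r<length gs. map ?m (rev gs) ! r)"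
    by (simp only: rev_map sum_list_sum_nth length_map length_rev atLeast0LessThan)
  also have "\<dots> = (\<Sum>r<length gs. ?m (rev gs ! r))" by (intro sum.cong) auto
  finally have eq: "sum_list (map (monom 1) (types gs)) = (\<Sum>r<length gs. ?m (rev gs ! r))" .
  have "(\<Sum>i\<le>d. monom (int (h i)) i) = sum_list (map (monom 1) (types gs))"
    unfolding assms(3)[symmetric] by (simp only: mset_map[symmetric] sum_mset_sum_list)
  then have "h_vector_is faces face_le bottom d h"
    unfolding h_vector_is_def h_polynomial using eq by (rule trans)
  then show ?thesis using simplicial dim realization_is_ball by blast
qed

lemma h_polynomial_split:
  assumes "0 < d" "h 0 = 1" "h d = (0 :: nat)"
  shows "(\<Sum>i\<le>d. monom (int (h i)) i) = (\<Sum>i\<in>{1..<d}. of_nat (h i) * monom (1 :: int) i) + monom 1 0"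
proof -
  have "{..d} = insert 0 (insert d {1..<d})" using assms(1) by auto
  moreover have "of_nat (h i) * monom (1 :: int) i = monom (int (h i)) i" for i
    by (simp add: of_nat_poly smult_monom)
  ultimately show ?thesis using assms by (simp add: add.commute)
qed

text \<open>The leading 1 is \<open>h 0\<close>, the type of the first simplex; the two sums count
  nonzero types only.\<close>

lemma partial_h_eq:
  assumes "l < d" "h 0 = 1" "h d = (0 :: nat)"
  shows "partial_h d h l = 1 + int (\<Sum>i\<in>{1..l}. h i) - int (\<Sum>i\<in>{d - l..<d}. h i)"
proof -
  have "(\<Sum>i\<le>l. int (h (d - i))) = (\<Sum>i\<in>{d - l..d}. int (h i))"
    by (rule sum.reindex_bij_witness[of _ "\<lambda>i. d - i" "\<lambda>i. d - i"]) (use assms(1) in auto)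
  moreover have "{d - l..d} = insert d {d - l..<d}" "{..l} = insert 0 {1..l}" by auto
  ultimately show ?thesis using assms by (simp add: partial_h_def sum_subtractf)
qed

lemma glued_positive:
  fixes h :: "nat \<Rightarrow> nat"
  assumes d: "0 < d" and h: "h 0 = 1" "h d = 0"
    and pos: "\<And>j. j \<le> (d - 1) div 2 \<Longrightarrow> partial_h d h j > 0"
  shows "\<exists>gs. glued d gs \<and> mset (types gs) = mset (expand h d) + {#0#}"
proof -
  let ?L = "expand h d"
  have sym: "?L ! k + ?L ! (length ?L - 1 - k) \<le> d" if "k < length ?L" for k
  proof (rule expand_symmetric_le[OF _ that])
    fix l assume l: "1 \<le> l" "l \<le> (d - 1) div 2"
    then have "l < d" using d by auto
    then show "(\<Sum>i\<in>{d - l..<d}. h i) \<le> (\<Sum>i\<in>{1..l}. h i)"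
      using partial_h_eq[OF \<open>l < d\<close> h] pos[OF l(2)] by linarith
  qed
  have "?L ! ((length ?L - 1) div 2) + hd (types [Map.empty]) \<le> d" if "?L \<noteq> []"
  proof -
    have "(length ?L - 1) div 2 < length ?L" using that by (cases ?L) auto
    then show ?thesis using set_expand[of "?L ! ((length ?L - 1) div 2)" h d] by simp
  qed
  then show ?thesis
    using glued_chain[OF sorted_expand _ sym glued.single] set_expand by fastforce
qed

lemma sum_atLeastAtMost_split: "n \<le> l \<Longrightarrow> sum h {1..l} = sum h {1..n} + sum h {n<..l}" for n l :: nat
  by (subst sum.union_disjoint[symmetric]) (auto intro!: sum.cong)

lemma sum_atLeastLessThan_split: "a \<le> b \<Longrightarrow> b \<le> d \<Longrightarrow> sum h {a..<d} = sum h {a..<b} + sum h {b..<d}" for a b d :: nat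
  by (simp add: sum.atLeastLessThan_concat)

lemma glued_zero:
  fixes h :: "nat \<Rightarrow> nat"
  assumes d: "0 < d" and h: "h 0 = 1" "h d = 0"
    and nonneg: "\<And>j. j \<le> (d - 1) div 2 \<Longrightarrow> partial_h d h j \<ge> 0"
    and n: "0 < n" "n \<le> (d - 1) div 2" "partial_h d h n = 0"
    and min: "\<And>m. 0 < m \<Longrightarrow> m < n \<Longrightarrow> partial_h d h m \<noteq> 0"
    and even: "even (\<Sum>i\<le>d. h i)"
    and upper: "\<And>l. n + 1 \<le> l \<Longrightarrow> l \<le> d - (n + 1) \<Longrightarrow>
      partial_h d h l \<le> (\<Sum>i\<le>n - 1. int (h (l - i)))"
  shows "\<exists>gs u v. glued d gs \<and> mset (types gs) = mset (expand u d) + (mset (expand v d) + {#0, d - n#}) \<and>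
    (\<forall>i\<in>{1..<d}. h i = u i + v i + (if i = d - n then 1 else 0))"
proof -
  define u where "u = (\<lambda>i. if n < i \<and> i < d - n then h i else 0)"
  \<comment> \<open>One copy of \<open>d - n\<close> is set aside; \<open>hdn\<close> shows that the
    truncated subtraction is a true one.\<close>
  define v where "v = (\<lambda>i. if i \<le> n \<or> d - n < i then h i else if i = d - n then h i - 1 else 0)"
  note of_nat_sum [simp del]
  have nd: "2 * n < d" using n(1,2) by linarith
  have part: "partial_h d h l = 1 + int (\<Sum>i\<in>{1..l}. h i) - int (\<Sum>i\<in>{d - l..<d}. h i)" if "l < d" for l
    by (rule partial_h_eq[OF that h])
  have pos: "0 < partial_h d h l" if "l < n" for l
    using min[of l] nonneg[of l] that n(2) part[of 0] by (cases "l = 0") fastforce+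
  have An: "sum h {d - n..<d} = 1 + sum h {1..n}" using part[of n] n(3) nd by simp
  \<comment> \<open>By minimality of \<open>n\<close>, \<open>partial_h\<close> drops from a
    positive value at \<open>n - 1\<close> to 0 at \<open>n\<close>, and only
    \<open>h (d - n)\<close> contributes negatively to this step.\<close>
  have hdn: "1 \<le> h (d - n)"
  proof -
    have "{1..n} = insert n {1..n - 1}" "{d - n..<d} = insert (d - n) {d - (n - 1)..<d}" using n(1) nd by auto
    then have "partial_h d h n = partial_h d h (n - 1) + int (h n) - int (h (d - n))"
      using part[of n] part[of "n - 1"] n(1) nd by simp
    then show ?thesis using pos[of "n - 1"] n(1,3) by simp
  qed
  have u_low: "sum u {1..l} = (if n \<le> l then sum h {n<..l} else 0)" if "l < d - n" for l
    using that by (auto simp: u_def intro!: sum.mono_neutral_cong_right)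
  have u_high: "sum u {l..<d} = (if l \<le> d - n then sum h {l..<d - n} else 0)" if "n < l" for l
    using that by (auto simp: u_def intro!: sum.mono_neutral_cong_right)
  have v_low: "sum v {1..l} = (if n \<le> l then sum h {1..n} else sum h {1..l})" if "l < d - n" for l
    using that by (auto simp: v_def intro!: sum.mono_neutral_cong_right)
  have v_top: "sum v {d - n..<d} = sum h {d - n..<d} - 1"
  proof -
    have "{d - n..<d} = insert (d - n) {d - n<..<d}" using n(1) nd by auto
    moreover have "sum v {d - n<..<d} = sum h {d - n<..<d}" using nd by (intro sum.cong) (auto simp: v_def)
    ultimately show ?thesis using hdn nd by (simp add: v_def)
  qed
  have v_high: "sum v {l..<d} = (if l \<le> d - n then sum h {d - n..<d} - 1 else sum h {l..<d})" if "n < l" for l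
  proof (cases "l \<le> d - n")
    case True
    have "sum v {l..<d} = sum v {d - n..<d}"
      using True that by (intro sum.mono_neutral_cong_right) (auto simp: v_def)
    then show ?thesis using True v_top by simp
  next
    case False
    then show ?thesis by (auto simp: v_def intro!: sum.cong)
  qed
  let ?U = "expand u d" and ?V = "expand v d"
  have split: "h i = u i + v i + (if i = d - n then 1 else 0)" for i
    using hdn nd by (auto simp: u_def v_def)
  have "(\<Sum>i\<le>d. h i) = 1 + sum h {1..<d}"
  proof -
    have "{..d} = insert 0 (insert d {1..<d})" using d by auto
    then show ?thesis using h d by simp
  qed
  also have "sum h {1..<d} = sum u {1..<d} + sum v {1..<d} + 1"
    using n(1) nd by (simp add: split sum.distrib)
  \<comment> \<open>Without the copy set aside, small and large types in \<open>v\<close> are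
    equally many. Type 0 and that copy add 2, so the parity of the whole sum passes to
    \<open>u\<close>.\<close>
  also have v_total: "sum v {1..<d} = 2 * sum h {1..n}"
  proof -
    have "sum v {1..<d} = sum v {1..n} + sum v {Suc n..<d}"
      using nd by (subst sum.union_disjoint[symmetric]) (auto intro!: sum.cong)
    then show ?thesis using v_low[of n] v_high[of "Suc n"] An nd by simp
  qed
  finally have "even (length ?U)" using even by (simp add: length_expand)
  moreover have U_mem: "1 \<le> x \<and> x \<le> d - n" if "x \<in> set ?U" for x
    using set_expand[OF that] by (auto simp: u_def split: if_splits)
  moreover have U_sym: "d - n \<le> ?U ! k + ?U ! (length ?U - 1 - k) \<and> ?U ! k + ?U ! (length ?U - 1 - k) \<le> d"
    if "k < length ?U" for k
  proof (intro conjI)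
    show "?U ! k + ?U ! (length ?U - 1 - k) \<le> d"
    proof (rule expand_symmetric_le[OF _ that])
      fix l assume l: "1 \<le> l" "l \<le> (d - 1) div 2"
      then have ld: "l < d - n" "n < d - l" using n(2) by linarith+
      show "(\<Sum>i\<in>{d - l..<d}. u i) \<le> (\<Sum>i\<in>{1..l}. u i)"
      proof (cases "n < l")
        case True
        \<comment> \<open>Subtracting \<open>sum h {d - n..<d} = 1 + sum h {1..n}\<close> cancels
          the 1 and leaves the inequality between the middle types.\<close>
        have "sum h {d - l..<d} \<le> 1 + sum h {1..l}" using nonneg[OF l(2)] part[of l] ld by simp
        then show ?thesis
          using True ld u_low[of l] u_high[of "d - l"] An sum_atLeastAtMost_split[of n l h]
            sum_atLeastLessThan_split[of "d - l" "d - n" d h] by simp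
      next
        case False
        then have "sum u {d - l..<d} = 0" using u_high[of "d - l"] ld by auto
        then show ?thesis by simp
      qed
    qed
    show "d - n \<le> ?U ! k + ?U ! (length ?U - 1 - k)"
    proof (rule expand_symmetric_ge[OF _ _ that])
      show "n < i \<and> i < d - n" if "u i \<noteq> 0" for i using that by (auto simp: u_def split: if_splits)
      fix j assume j: "n < j" "j < d - 2 * n"
      \<comment> \<open>For this \<open>l\<close> the right-hand side of \<open>upper\<close> is the
        sum of \<open>h\<close> over \<open>{j<..l}\<close>, which cancels the upper part of
        \<open>sum h {1..l}\<close>.\<close>
      define l where "l = n + j"
      have l: "n + 1 \<le> l" "l \<le> d - (n + 1)" "l < d" using j n(1) by (auto simp: l_def)
      have "(\<Sum>i\<le>n - 1. int (h (l - i))) = (\<Sum>i\<in>{j<..l}. int (h i))"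
        by (rule sum.reindex_bij_witness[of _ "\<lambda>i. l - i" "\<lambda>i. l - i"]) (use n(1) in \<open>auto simp: l_def\<close>)
      then have "1 + int (sum h {1..l}) - int (sum h {d - l..<d}) \<le> int (sum h {j<..l})"
        using upper[OF l(1,2)] part[OF l(3)] by (simp add: of_nat_sum)
      then have "1 + sum h {1..j} \<le> sum h {d - l..<d}"
        using sum_atLeastAtMost_split[of j l h] by (simp add: l_def)
      moreover have "d - n - j = d - l" by (simp add: l_def)
      ultimately show "(\<Sum>i\<in>{1..j}. u i) \<le> (\<Sum>i\<in>{d - n - j..<d}. u i)"
        using j u_low[of j] u_high[of "d - l"] An sum_atLeastAtMost_split[of n j h]
          sum_atLeastLessThan_split[of "d - l" "d - n" d h] l_def by simp
    qed
  qed
  moreover have "gluable d [Map.empty] {..<d - n} (\<lambda>_. 0)"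
    by (rule gluable_subset[OF gluable_last[OF glued.single]]) auto
  ultimately obtain gs1 \<rho> where gs1: "glued d gs1" "mset (types gs1) = mset (types [Map.empty]) + mset ?U"
    "gluable d gs1 {..<d - n} \<rho>"
    using glued_pairs[of ?U "d - n" d "[Map.empty]" "\<lambda>_. 0"] glued.single by blast
  \<comment> \<open>The simplex of type \<open>d - n\<close> covers the whole patch preserved by the
    pairs; its \<open>n\<close> free facets can receive the middle entry of
    \<open>?V\<close>.\<close>
  define g where "g = (\<lambda>c. if c < d - n then Some (\<rho> c) else None)"
  have dom: "dom g = {..<d - n}" by (auto simp: g_def dom_def)
  have gl2: "glued d (g # gs1)"
  proof (rule glued.attach[OF gs1(1)])
    show "gluable d gs1 (dom g) (\<lambda>c. the (g c))"
      unfolding dom by (rule gluable_subset[OF gs1(3)]) (auto simp: g_def)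
    have "0 \<in> dom g" using nd by (simp add: dom)
    then show "dom g \<noteq> {}" by blast
    have "d - n \<in> {..<d}" "d - n \<notin> dom g" "dom g \<subseteq> {..<d}" using n(1) nd by (auto simp: dom)
    then show "dom g \<subset> {..<d}" by blast
  qed
  have V_sym: "?V ! k + ?V ! (length ?V - 1 - k) \<le> d" if "k < length ?V" for k
  proof (rule expand_symmetric_le[OF _ that])
    fix l assume l: "1 \<le> l" "l \<le> (d - 1) div 2"
    then have ld: "l < d - n" "n < d - l" "l < d" using n(2) by linarith+
    show "(\<Sum>i\<in>{d - l..<d}. v i) \<le> (\<Sum>i\<in>{1..l}. v i)"
    \<comment> \<open>For \<open>l \<ge> n\<close> both sums equal \<open>sum h {1..n}\<close>; for
      smaller \<open>l\<close> strict positivity of \<open>partial_h\<close> gives the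
      inequality.\<close>
    proof (cases "n \<le> l")
      case True
      then have "d - l \<le> d - n" by simp
      then show ?thesis using True v_low[of l] v_high[of "d - l"] ld An by simp
    next
      case False
      then have "sum h {d - l..<d} \<le> sum h {1..l}" using pos[of l] part[of l] ld by simp
      moreover have "\<not> d - l \<le> d - n" using False ld by linarith
      ultimately show ?thesis using False v_low[of l] v_high[of "d - l"] ld by simp
    qed
  qed
  have "?V ! ((length ?V - 1) div 2) + hd (types (g # gs1)) \<le> d" if "?V \<noteq> []"
  proof -
    \<comment> \<open>Exactly half of the entries of \<open>?V\<close> are at most \<open>n\<close>,
      and the index \<open>(length ?V - 1) div 2\<close> picks the lower of the two middle
      entries.\<close>
    have len: "length ?V = 2 * sum h {1..n}" using v_total by (simp add: length_expand)
    then have "(length ?V - 1) div 2 < sum h {1..n}" using that by (cases "sum h {1..n}") auto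
    also have "\<dots> = length (filter (\<lambda>x. x \<le> n) ?V)"
      using nd v_low[of n] by (simp add: length_filter_expand_le)
    finally have "?V ! ((length ?V - 1) div 2) \<le> n"
      using that by (subst sorted_nth_le_iff[OF sorted_expand]) (auto intro: le_less_trans[OF div_le_dividend])
    then show ?thesis using nd by (simp add: dom)
  qed
  then obtain gs where "glued d gs" "mset (types gs) = mset (types (g # gs1)) + mset ?V"
    using glued_chain[OF sorted_expand _ V_sym gl2] set_expand by fastforce
  then have "glued d gs \<and> mset (types gs) = mset ?U + (mset ?V + {#0, d - n#})"
    using gs1(2) by (simp add: dom)
  then show ?thesis using split by blast
qed

theorem theorem6p2:
  fixes d :: nat and h :: "nat \<Rightarrow> nat"
  assumes h0: "h 0 = 1" and hd: "h d = 0"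
  assumes cases:
    "(\<forall>j\<le>(d - 1) div 2. partial_h d h j > 0)
     \<or> ((\<forall>j\<le>(d - 1) div 2. partial_h d h j \<ge> 0) \<and>
        (\<exists>n. 0 < n \<and> n \<le> (d - 1) div 2 \<and> partial_h d h n = 0 \<and>
             (\<forall>m. 0 < m \<and> m < n \<longrightarrow> partial_h d h m \<noteq> 0) \<and>
             even (\<Sum>i\<le>d. h i) \<and>
             (\<forall>l. n + 1 \<le> l \<and> l \<le> d - (n + 1) \<longrightarrow>
                  partial_h d h l \<le> (\<Sum>i\<le>n - 1. int (h (l - i))))))"
  shows "\<exists>(P::nat set) le z. simplicial_poset P le z \<and> has_dim P le z d \<and>
           is_ball_of_dim (realization P le z) (d - 1) \<and> h_vector_is P le z d h"
proof -
  have d: "0 < d" using h0 hd by (cases d) auto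
  have "\<exists>gs. glued d gs \<and> (\<Sum>t\<in>#mset (types gs). monom 1 t) = (\<Sum>i\<le>d. monom (int (h i)) i)"
    using cases
  proof
    assume "\<forall>j\<le>(d - 1) div 2. partial_h d h j > 0"
    then obtain gs where gs: "glued d gs" "mset (types gs) = mset (expand h d) + {#0#}"
      using glued_positive[of d h] d h0 hd by blast
    have "(\<Sum>t\<in>#mset (types gs). monom 1 t) = (\<Sum>i\<le>d. monom (int (h i)) i)"
      unfolding gs(2) h_polynomial_split[OF d h0 hd] by (simp add: sum_mset_expand)
    then show ?thesis using gs(1) by blast
  next
    assume "(\<forall>j\<le>(d - 1) div 2. partial_h d h j \<ge> 0) \<and>
        (\<exists>n. 0 < n \<and> n \<le> (d - 1) div 2 \<and> partial_h d h n = 0 \<and>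
             (\<forall>m. 0 < m \<and> m < n \<longrightarrow> partial_h d h m \<noteq> 0) \<and>
             even (\<Sum>i\<le>d. h i) \<and>
             (\<forall>l. n + 1 \<le> l \<and> l \<le> d - (n + 1) \<longrightarrow>
                  partial_h d h l \<le> (\<Sum>i\<le>n - 1. int (h (l - i)))))"
      (is "?nonneg \<and> (\<exists>n. ?P n)")
    then have nonneg: ?nonneg and "\<exists>n. ?P n" by (rule conjunct1, rule conjunct2)
    from this(2) obtain n where n: "?P n" by (rule exE)
    obtain gs u v where gs: "glued d gs" "mset (types gs) = mset (expand u d) + (mset (expand v d) + {#0, d - n#})"
      and split: "\<forall>i\<in>{1..<d}. h i = u i + v i + (if i = d - n then 1 else 0)"
      using glued_zero[of d h n] d h0 hd nonneg n by auto
    let ?m = "\<lambda>i. monom (1 :: int) i"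
    have dn: "d - n \<in> {1..<d}" using n by auto
    have "(\<Sum>t\<in>#mset (types gs). ?m t) = (\<Sum>i\<in>{1..<d}. of_nat (u i) * ?m i) +
        ((\<Sum>i\<in>{1..<d}. of_nat (v i) * ?m i) + (?m 0 + ?m (d - n)))"
      unfolding gs(2) by (simp add: sum_mset_expand)
    also have "\<dots> = (\<Sum>i\<in>{1..<d}. of_nat (u i) * ?m i + of_nat (v i) * ?m i +
        (if i = d - n then ?m i else 0)) + ?m 0"
      using dn by (simp add: sum.distrib)
    also have "\<dots> = (\<Sum>i\<in>{1..<d}. of_nat (h i) * ?m i) + ?m 0"
      using split by (intro arg_cong2[where f = "(+)"] sum.cong refl) (simp add: algebra_simps)
    also have "\<dots> = (\<Sum>i\<le>d. monom (int (h i)) i)" by (rule h_polynomial_split[OF d h0 hd, symmetric])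
    finally show ?thesis using gs(1) by blast
  qed
  then show ?thesis using poset_ball_from_glued d by blast
qed

end
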